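(* Let $E(q)=\prod_{k\ge1}(1-q^k)$, $X=\frac{E(q^2)^4E(q^3)^8}{E(q)^8E(q^6)^4}$, and define $g(n)$ by $\sum_{n\ge0}g(n)q^n=\frac{E(q^2)^5}{E(q)^4}$. Define integer matrices $(a(i,j))_{i,j\ge1}$ and $(b(i,j))_{i,j\ge1}$ as follows. The first three rows are (entries listed for $j=1,2,\dots$; all further entries in these rows are $0$): \begin{itemize} \item $a(1,\cdot)=(10,-36,27)$; $a(2,\cdot)=(-8,306,-2160,5508,-5832,2187)$; $a(3,\cdot)=(1,-360,10566,-99144,423549,-944784,1141614,-708588,177147)$; \item $b(1,\cdot)=(-9,252,-891,729)$; $b(2,\cdot)=(1,-378,8613,-54675,138510,-150903,59049)$; $b(3,\cdot)=(0,147,-14553,312255,-2617839,10764414,-23914845,29288304,-18600435,4782969)$. \end{itemize} For $i\ge4$ and $j\ge1$, both $m=a$ and $m=b$ satisfy $$m(i,j)=30m(i-1,j-1)-108m(i-1,j-2)+81m(i-1,j-3)-12m(i-2,j-1)+9m(i-2,j-2)+m(i-3,j-1),$$ with $m(i,j)=0$ whenever $j\le0$. Define integer sequences $d_\alpha=(d_\alpha(j))_{j\ge1}$ for $\alpha\ge1$ by $d_1=(9,0,0,\dots)$ and, for $\alpha\ge2$, $d_\alpha(j)=\sum_{k\ge1}a(k,j)d_{\alpha-1}(k)$ if $\alpha$ is even and $d_\alpha(j)=\sum_{k\ge1}b(k,j)d_{\alpha-1}(k)$ if $\alpha$ is odd. Then for every $\alpha\ge1$, \begin{align*} \sum_{n\ge0}g\left(3^{2\alpha-1}n+\frac{3^{2\alpha}-1}{4}\right)q^n&=\frac{E(q^6)^5}{E(q^3)^4}\sum_{j\ge1}d_{2\alpha-1}(j)X^j,\\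 \sum_{n\ge0}g\left(3^{2\alpha}n+\frac{3^{2\alpha}-1}{4}\right)q^n&=\frac{E(q^2)^5}{E(q)^4}\sum_{j\ge1}d_{2\alpha}(j)X^j. \end{align*}
   Context: All sums defining $d_\alpha(j)$ are finite (each $d_\alpha$ has finitely many nonzero entries). Identities are of formal power series in $q$. *)

theory Defs
  imports "HOL-Computational_Algebra.Formal_Power_Series"
begin

(* Euler product E(q) = prod_{k>=1} (1 - q^k); its n-th coefficient equals
   that of the finite product over k = 1..n. *)
definition euler_E :: "rat fps" where
  "euler_E = Abs_fps (\<lambda>n. fps_nth (\<Prod>k\<in>{1..n}. (1 - fps_X ^ k)) n)"

definition euler_Em :: "nat \<Rightarrow> rat fps" where
  "euler_Em m = fps_compose euler_E (fps_X ^ m)"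

definition X_fps :: "rat fps" where
  "X_fps = (euler_Em 2 ^ 4 * euler_Em 3 ^ 8) / (euler_Em 1 ^ 8 * euler_Em 6 ^ 4)"

definition G_fps :: "rat fps" where
  "G_fps = euler_Em 2 ^ 5 / euler_Em 1 ^ 4"

definition g :: "nat \<Rightarrow> rat" where
  "g n = fps_nth G_fps n"

definition row_entry :: "int list \<Rightarrow> nat \<Rightarrow> int" where
  "row_entry r j = (if 1 \<le> j \<and> j \<le> length r then r ! (j - 1) else 0)"

definition a_init :: "nat \<Rightarrow> nat \<Rightarrow> int" where
  "a_init i j = (if i = 1 then row_entry [10,-36,27] j
     else if i = 2 then row_entry [-8,306,-2160,5508,-5832,2187] j
     else if i = 3 then row_entry [1,-360,10566,-99144,423549,-944784,1141614,-708588,177147] j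
     else 0)"

definition b_init :: "nat \<Rightarrow> nat \<Rightarrow> int" where
  "b_init i j = (if i = 1 then row_entry [-9,252,-891,729] j
     else if i = 2 then row_entry [1,-378,8613,-54675,138510,-150903,59049] j
     else if i = 3 then row_entry [0,147,-14553,312255,-2617839,10764414,-23914845,29288304,-18600435,4782969] j
     else 0)"

(* Matrix with rows 1..3 given by r and rows i >= 4 by the recurrence;
   entries with column index j <= 0 are 0 (nat truncation maps j-k <= 0 to 0). *)
fun rec_mat :: "(nat \<Rightarrow> nat \<Rightarrow> int) \<Rightarrow> nat \<Rightarrow> nat \<Rightarrow> int" where
  "rec_mat r i j =
    (if j = 0 then 0
     else if i \<le> 3 then r i j
     else 30 * rec_mat r (i-1) (j-1) - 108 * rec_mat r (i-1) (j-2)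
          + 81 * rec_mat r (i-1) (j-3) - 12 * rec_mat r (i-2) (j-1)
          + 9 * rec_mat r (i-2) (j-2) + rec_mat r (i-3) (j-1))"

definition a_mat :: "nat \<Rightarrow> nat \<Rightarrow> int" where "a_mat = rec_mat a_init"
definition b_mat :: "nat \<Rightarrow> nat \<Rightarrow> int" where "b_mat = rec_mat b_init"

(* finite sum over the (finite) support {k >= 1. v k \<noteq> 0} *)
definition mat_step :: "(nat \<Rightarrow> nat \<Rightarrow> int) \<Rightarrow> (nat \<Rightarrow> int) \<Rightarrow> nat \<Rightarrow> int" where
  "mat_step m v j = (\<Sum>k\<in>{k. 1 \<le> k \<and> v k \<noteq> 0}. m k j * v k)"

fun d :: "nat \<Rightarrow> nat \<Rightarrow> int" where
  "d 0 = (\<lambda>j. 0)"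
| "d (Suc 0) = (\<lambda>j. if j = 1 then 9 else 0)"
| "d (Suc (Suc n)) = mat_step (if even (Suc (Suc n)) then a_mat else b_mat) (d (Suc n))"

definition X_series :: "(nat \<Rightarrow> int) \<Rightarrow> rat fps" where
  "X_series v = (\<Sum>j\<in>{j. 1 \<le> j \<and> v j \<noteq> 0}. fps_const (of_int (v j)) * X_fps ^ j)"

end

theory Submission
  imports Defs
begin

unbundle fps_syntax

text \<open>
  Write \<open>P(q) = \<phi>(-q) = E(q)\<^sup>2/E(q\<^sup>2)\<close> and \<open>\<psi>(q) = E(q\<^sup>2)\<^sup>2/E(q)\<close>, so that
  \<open>X = (P(q\<^sup>3)/P(q))\<^sup>4\<close> and the generating function of \<open>g\<close> is \<open>G = \<psi>\<^sup>2/P\<close>.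
  Splitting the theta series modulo 3 and applying Jacobi's triple product to the parts gives
  \<open>P(q) = P(q\<^sup>9)(1 - 2u)\<close> and \<open>\<psi>(q) = A(q\<^sup>3)(1 + u)\<close> with the same \<open>u \<in> q\<rat>[[q\<^sup>3]]\<close>.
  The norm of \<open>P\<close> from \<open>\<rat>[[q]]\<close> to \<open>\<rat>[[q\<^sup>3]]\<close> can be read off both this dissection and the product, so
  \<open>T = X(q\<^sup>3) = 1/(1 - 8u\<^sup>3)\<close> and \<open>X = (1 - 8u\<^sup>3)/(1 - 2u)\<^sup>4\<close>. Hence \<open>X\<close> is a root of
  a cubic over \<open>\<int>[T]\<close>, which is the recurrence defining the two matrices, and the sections of
  \<open>X\<^sup>i\<close> and \<open>G X\<^sup>i\<close> along residue classes modulo 3 are found by collecting powers of \<open>u\<close>.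
\<close>

subsection \<open>Limits of formal power series\<close>

lemma tendsto_add_fps:
  fixes f g :: "'b \<Rightarrow> 'a :: comm_ring_1 fps"
  assumes "(f \<longlongrightarrow> a) F" "(g \<longlongrightarrow> b) F"
  shows "((\<lambda>x. f x + g x) \<longlongrightarrow> a + b) F"
proof (rule tendsto_fpsI)
  fix n
  have "eventually (\<lambda>x. f x $ n = a $ n) F" "eventually (\<lambda>x. g x $ n = b $ n) F"
    using assms by (auto simp: tendsto_fps_iff)
  then show "eventually (\<lambda>x. (f x + g x) $ n = (a + b) $ n) F"
    by eventually_elim simp
qed

text \<open>Convergence means that each coefficient is eventually constant. Coefficient
  \<open>n\<close> of a product depends only on coefficients up to \<open>n\<close> of the factors,
  so finitely many eventual equalities suffice; composition works the same way.\<close>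

lemma tendsto_mult_fps:
  fixes f g :: "'b \<Rightarrow> 'a :: comm_ring_1 fps"
  assumes "(f \<longlongrightarrow> a) F" "(g \<longlongrightarrow> b) F"
  shows "((\<lambda>x. f x * g x) \<longlongrightarrow> a * b) F"
proof (rule tendsto_fpsI)
  fix n
  have "eventually (\<lambda>x. \<forall>i\<in>{0..n}. f x $ i = a $ i) F" "eventually (\<lambda>x. \<forall>i\<in>{0..n}. g x $ i = b $ i) F"
    using assms by (auto simp: tendsto_fps_iff intro!: eventually_ball_finite)
  then show "eventually (\<lambda>x. (f x * g x) $ n = (a * b) $ n) F"
    by eventually_elim (simp add: fps_mult_nth)
qed

lemma tendsto_power_fps:
  fixes f :: "'b \<Rightarrow> 'a :: comm_ring_1 fps"
  assumes "(f \<longlongrightarrow> a) F"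
  shows "((\<lambda>x. f x ^ n) \<longlongrightarrow> a ^ n) F"
  by (induction n) (use assms in \<open>auto intro: tendsto_mult_fps\<close>)

lemma tendsto_sum_fps:
  fixes f :: "'c \<Rightarrow> 'b \<Rightarrow> 'a :: comm_ring_1 fps"
  assumes "\<And>i. i \<in> I \<Longrightarrow> (f i \<longlongrightarrow> a i) F"
  shows "((\<lambda>x. \<Sum>i\<in>I. f i x) \<longlongrightarrow> (\<Sum>i\<in>I. a i)) F"
  using assms
  by (induction I rule: infinite_finite_induct) (auto intro!: tendsto_add_fps)

lemma tendsto_compose_fps:
  fixes f :: "'b \<Rightarrow> 'a :: comm_ring_1 fps"
  assumes "(f \<longlongrightarrow> a) F"
  shows "((\<lambda>x. f x oo y) \<longlongrightarrow> (a oo y)) F"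
proof (rule tendsto_fpsI)
  fix n
  have "eventually (\<lambda>x. \<forall>i\<in>{0..n}. f x $ i = a $ i) F"
    using assms by (auto simp: tendsto_fps_iff intro!: eventually_ball_finite)
  then show "eventually (\<lambda>x. (f x oo y) $ n = (a oo y) $ n) F"
    by eventually_elim (simp add: fps_compose_nth)
qed

lemma tendsto_power_0_fps:
  fixes y :: "'a :: comm_ring_1 fps"
  assumes "y $ 0 = 0"
  shows "(\<lambda>n. y ^ n) \<longlonglongrightarrow> 0"
proof (rule tendsto_fpsI)
  fix k
  show "eventually (\<lambda>n. (y ^ n) $ k = 0 $ k) sequentially"
    using eventually_gt_at_top[of k]
    by eventually_elim (use assms in \<open>simp add: startsby_zero_power_prefix\<close>)
qed

section \<open>The finite products (y; y)_n and their limit, the Euler product\<close>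

definition qpoch :: "rat fps \<Rightarrow> nat \<Rightarrow> rat fps" where
  "qpoch y n = (\<Prod>i<n. 1 - y ^ Suc i)"

lemma qpoch_0 [simp]: "qpoch y 0 = 1"
  and qpoch_Suc [simp]: "qpoch y (Suc n) = qpoch y n * (1 - y ^ Suc n)"
  by (simp_all add: qpoch_def)

lemma qpoch_nth_0: "y $ 0 = 0 \<Longrightarrow> qpoch y n $ 0 = 1"
  by (induction n) simp_all

lemma qpoch_compose: "y $ 0 = 0 \<Longrightarrow> qpoch fps_X n oo y = qpoch y n"
  by (simp add: qpoch_def fps_compose_prod_distrib fps_compose_sub_distrib fps_X_power_compose
           del: power_Suc)

text \<open>Passing from \<open>n\<close> to \<open>Suc n\<close> subtracts a multiple of
  \<open>fps_X ^ Suc n\<close>, which leaves coefficient \<open>k \<le> n\<close> alone. The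
  truncation that defines \<open>euler_E $ k\<close> is therefore already final.\<close>

lemma qpoch_fps_X_nth: "n \<ge> k \<Longrightarrow> qpoch fps_X n $ k = euler_E $ k"
proof (induction n rule: dec_induct)
  case base
  have "(\<Prod>i\<in>{1..k}. 1 - fps_X ^ i :: rat fps) = qpoch fps_X k"
    unfolding qpoch_def by (rule prod.reindex_bij_witness[of _ Suc "\<lambda>i. i - 1"]) auto
  then show ?case by (simp add: euler_E_def)
next
  case (step n)
  have "qpoch fps_X (Suc n) $ k = qpoch fps_X n $ k - (qpoch fps_X n * fps_X ^ Suc n) $ k"
    by (simp add: algebra_simps)
  also have "(qpoch fps_X n * fps_X ^ Suc n) $ k = 0"
    using step.hyps by (subst fps_X_power_mult_right_nth) auto
  finally show ?case using step.IH by simp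
qed

lemma qpoch_tendsto_euler:
  assumes "y $ 0 = 0"
  shows "(\<lambda>n. qpoch y n) \<longlonglongrightarrow> (euler_E oo y)"
proof -
  have "(\<lambda>n. qpoch fps_X n) \<longlonglongrightarrow> euler_E"
    by (rule tendsto_fpsI)
      (use qpoch_fps_X_nth in \<open>auto intro: eventually_mono[OF eventually_ge_at_top]\<close>)
  from tendsto_compose_fps[OF this, of y] show ?thesis
    using assms by (simp add: qpoch_compose)
qed

lemma euler_E_nth_0 [simp]: "euler_E $ 0 = 1"
  by (simp add: euler_E_def)

subsection \<open>Jacobi's triple product\<close>

text \<open>Triangular numbers at all integers. They are nonnegative for negative \<open>j\<close>
  too, so \<open>nat\<close> loses nothing and two-sided series get natural exponents.\<close>

definition tri :: "int \<Rightarrow> nat" where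
  "tri j = nat (j * (j + 1) div 2)"

lemma tri_pred: "int (tri j) = int (tri (j - 1)) + j"
proof -
  have "j * (j + 1) = (j - 1) * (j - 1 + 1) + 2 * j"
    by (simp add: algebra_simps)
  then have *: "j * (j + 1) div 2 = (j - 1) * (j - 1 + 1) div 2 + j"
    by simp
  have "i * (i + 1) \<ge> 0" for i :: int
    by (cases "i \<ge> 0") (auto intro: mult_nonneg_nonneg mult_nonpos_nonpos)
  then have "i * (i + 1) div 2 \<ge> 0" for i :: int
    by (simp add: pos_imp_zdiv_nonneg_iff)
  then have "int (tri i) = i * (i + 1) div 2" for i
    by (simp add: tri_def)
  then show ?thesis using * by simp
qed

lemma tri_uminus: "tri (- j) = tri (j - 1)"
  by (simp add: tri_def algebra_simps)

lemma two_tri: "2 * int (tri j) = j * (j + 1)"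
proof (induction j rule: int_induct[of _ 0])
  case base
  then show ?case by (simp add: tri_def)
next
  case (step1 i)
  then show ?case using tri_pred[of "i + 1"] by (simp add: algebra_simps)
next
  case (step2 i)
  then show ?case using tri_pred[of i] by (simp add: algebra_simps)
qed

text \<open>The term a^(j(j+1)/2) b^(j(j-1)/2) of Ramanujan's general theta function f(a,
  b).\<close>

definition theta_term :: "rat fps \<Rightarrow> rat fps \<Rightarrow> int \<Rightarrow> rat fps" where
  "theta_term a b j = a ^ tri j * b ^ tri (j - 1)"

text \<open>The sum over all integers \<open>j\<close>, taken coefficientwise. If
  \<open>a * b\<close> has constant term 0, indices outside the window contribute nothing to
  coefficient \<open>k\<close> (\<open>theta_term_nth_eq_0\<close>).\<close>

definition theta :: "rat fps \<Rightarrow> rat fps \<Rightarrow> rat fps" where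
  "theta a b = Abs_fps (\<lambda>k. (\<Sum>j\<in>{- int (k + 1)..int (k + 1)}. theta_term a b j) $ k)"

lemma theta_term_uminus: "theta_term a b (- j) = theta_term b a j"
proof -
  have "- j - 1 = - (j + 1)" by simp
  then have "tri (- j - 1) = tri j" by (simp only: tri_uminus) simp
  then show ?thesis by (simp add: theta_term_def tri_uminus mult.commute)
qed

text \<open>For positive \<open>j\<close> the term is a^j (ab)^(j(j-1)/2), and j(j-1)/2 exceeds
  \<open>k\<close>. Only the product \<open>a * b\<close> has to vanish at 0, which admits
  \<open>a = 1\<close>, the case of \<open>psi2\<close>.\<close>

lemma theta_term_nth_eq_0_pos:
  assumes "(a * b) $ 0 = 0" "j > int (k + 1)"
  shows "theta_term a b j $ k = 0"
proof -
  have "int (tri j) = int (tri (j - 1) + nat j)"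
    using assms tri_pred[of j] by simp
  then have *: "tri j = tri (j - 1) + nat j" by linarith
  have "theta_term a b j = a ^ nat j * (a * b) ^ tri (j - 1)"
    by (simp add: theta_term_def * power_add power_mult_distrib mult_ac)
  moreover have "tri (j - 1) > k"
  proof -
    have "2 * int (tri (j - 1)) = (j - 1) * j" using two_tri[of "j - 1"] by simp
    moreover have "(j - 1) * 2 \<le> (j - 1) * j" using assms by (intro mult_left_mono) auto
    ultimately have "2 * int (tri (j - 1)) \<ge> (j - 1) * 2" by simp
    then have "int k < int (tri (j - 1))" using assms(2) by simp
    then show ?thesis by simp
  qed
  then have "(a * b) ^ tri (j - 1) $ i = 0" if "i \<le> k" for i
    using assms that by (intro startsby_zero_power_prefix[rule_format]) auto
  ultimately show ?thesis
    by (auto simp: fps_mult_nth intro!: sum.neutral)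
qed

lemma theta_term_nth_eq_0:
  assumes "(a * b) $ 0 = 0" "\<bar>j\<bar> > int (k + 1)"
  shows "theta_term a b j $ k = 0"
proof (cases "j > 0")
  case False
  then show ?thesis
    using theta_term_nth_eq_0_pos[of b a k "-j"] theta_term_uminus[of a b "-j"] assms
    by (simp add: mult.commute)
qed (use assms theta_term_nth_eq_0_pos in auto)

text \<open>Tannery's theorem: each coefficient involves only boundedly many \<open>j\<close>.\<close>

lemma theta_tannery:
  assumes ab: "(a * b) $ 0 = 0"
    and c: "\<And>j. (\<lambda>n. c n j) \<longlonglongrightarrow> 1"
  shows "(\<lambda>n. \<Sum>j\<in>{- int n..int n}. theta_term a b j * c n j) \<longlonglongrightarrow> theta a b"
proof (rule tendsto_fpsI)
  fix k
  let ?J = "{- int (k + 1)..int (k + 1)}"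
  have "(\<lambda>n. \<Sum>j\<in>?J. theta_term a b j * c n j) \<longlonglongrightarrow> (\<Sum>j\<in>?J. theta_term a b j * 1)"
    by (intro tendsto_sum_fps tendsto_mult_fps c tendsto_const)
  then have "eventually (\<lambda>n. (\<Sum>j\<in>?J. theta_term a b j * c n j) $ k = theta a b $ k) sequentially"
    by (simp add: tendsto_fps_iff theta_def)
  then show "eventually (\<lambda>n. (\<Sum>j\<in>{- int n..int n}. theta_term a b j * c n j) $ k = theta a b $ k)
      sequentially"
    using eventually_ge_at_top[of "k + 1"]
  proof eventually_elim
    case (elim n)
    have "(theta_term a b j * c n j) $ k = 0" if "\<bar>j\<bar> > int (k + 1)" for j
      using that theta_term_nth_eq_0[OF ab]
      by (auto simp: fps_mult_nth intro!: sum.neutral)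
    then have "(\<Sum>j\<in>{- int n..int n}. (theta_term a b j * c n j) $ k)
        = (\<Sum>j\<in>?J. (theta_term a b j * c n j) $ k)"
      using elim(2) by (intro sum.mono_neutral_right) auto
    then show ?case using elim(1) by (simp add: fps_sum_nth)
  qed
qed

lemma theta_tendsto:
  assumes "(a * b) $ 0 = 0"
  shows "(\<lambda>n. \<Sum>j\<in>{- int n..int n}. theta_term a b j) \<longlonglongrightarrow> theta a b"
  using theta_tannery[OF assms, of "\<lambda>_ _. 1"] by simp

lemma theta_commute: "theta a b = theta b a"
proof -
  have "(\<Sum>j\<in>{- n..n}. theta_term a b j) = (\<Sum>j\<in>{- n..n}. theta_term b a j)" for n
    by (rule sum.reindex_bij_witness[of _ uminus uminus]) (auto simp: theta_term_uminus)
  then show ?thesis unfolding theta_def by (simp only: )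
qed

section \<open>A finite form of the triple product\<close>

definition inv_qpoch :: "rat fps \<Rightarrow> int \<Rightarrow> rat fps" where
  "inv_qpoch y m = (if m < 0 then 0 else inverse (qpoch y (nat m)))"

lemma inverse_qpoch_Suc:
  assumes "y $ 0 = 0"
  shows "inverse (qpoch y n) = (1 - y ^ Suc n) * inverse (qpoch y (Suc n))"
proof -
  have "(1 - y ^ Suc n) $ 0 \<noteq> 0" using assms by simp
  from inverse_mult_eq_1[OF this]
  have "(1 - y ^ Suc n) * inverse (1 - y ^ Suc n) = 1" by (simp only: mult.commute)
  then show ?thesis
    unfolding qpoch_Suc fps_inverse_mult by (simp only: mult.left_commute mult_1_right)
qed

text \<open>This holds at every integer: for \<open>m \<le> 0\<close> the factor is
  \<open>1 - y ^ 0 = 0\<close>, in agreement with the value 0 of \<open>inv_qpoch\<close> at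
  negative arguments.\<close>

lemma inv_qpoch_pred:
  assumes "y $ 0 = 0"
  shows "inv_qpoch y (m - 1) = (1 - y ^ nat m) * inv_qpoch y m"
proof (cases "m \<le> 0")
  case True
  then show ?thesis by (simp add: inv_qpoch_def)
next
  case False
  then have "nat m = Suc (nat (m - 1))" by simp
  then show ?thesis using False inverse_qpoch_Suc[OF assms, of "nat (m - 1)"]
    by (simp add: inv_qpoch_def del: qpoch_Suc power_Suc)
qed

text \<open>Comparison of the coefficients of \<open>theta_term a b j\<close> when the finite
  product gains its factors for \<open>i = n\<close>. With y = ab these multiply to 1 + y^(2n+1) + a
  y^n + b y^n, and the last two summands bring in the indices \<open>j - 1\<close> and
  \<open>j + 1\<close>.\<close>

lemma triple_product_coeff_rec:
  assumes y: "y $ 0 = 0" and j: "\<bar>j\<bar> \<le> int n + 1"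
  shows "(1 - y ^ (2 * n + 1)) * (1 - y ^ (2 * n + 2)) *
      (inv_qpoch y (int n + 1 + j) * inv_qpoch y (int n + 1 - j)) =
    (1 + y ^ (2 * n + 1)) * (inv_qpoch y (int n + j) * inv_qpoch y (int n - j)) +
    y ^ nat (int n + 1 - j) * (inv_qpoch y (int n + j - 1) * inv_qpoch y (int n + 1 - j)) +
    y ^ nat (int n + 1 + j) * (inv_qpoch y (int n + 1 + j) * inv_qpoch y (int n - j - 1))"
proof -
  define p r where "p = inv_qpoch y (int n + 1 + j)" and "r = inv_qpoch y (int n + 1 - j)"
  define x z where "x = y ^ nat (int n + 1 + j)" and "z = y ^ nat (int n + 1 - j)"
  define x' z' where "x' = y ^ nat (int n + j)" and "z' = y ^ nat (int n - j)"
  have e1: "inv_qpoch y (int n + j) = (1 - x) * p"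
    using inv_qpoch_pred[OF y, of "int n + 1 + j"] by (simp add: p_def x_def)
  have e2: "inv_qpoch y (int n - j) = (1 - z) * r"
    using inv_qpoch_pred[OF y, of "int n + 1 - j"] by (simp add: r_def z_def)
  have e3: "inv_qpoch y (int n + j - 1) = (1 - x') * ((1 - x) * p)"
    using inv_qpoch_pred[OF y, of "int n + j"] by (simp add: x'_def e1)
  have e4: "inv_qpoch y (int n - j - 1) = (1 - z') * ((1 - z) * r)"
    using inv_qpoch_pred[OF y, of "int n - j"] by (simp add: z'_def e2)
  \<comment> \<open>What remains after removing \<open>p * r\<close> is an identity between powers
    of \<open>y\<close>. At \<open>j = int n + 1\<close> and \<open>j = - (int n + 1)\<close> one of
    the exponents \<open>int n - j\<close>, \<open>int n + j\<close> is truncated by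
    \<open>nat\<close>, but then \<open>z = 1\<close> or \<open>x = 1\<close> kills the affected
    term. Otherwise everything is a polynomial in \<open>y\<close>, \<open>x'\<close>,
    \<open>z'\<close> with x' z' = y^(2n).\<close>
  have key: "(1 - y ^ (2 * n + 1)) * (1 - y ^ (2 * n + 2)) =
    (1 + y ^ (2 * n + 1)) * (1 - x) * (1 - z) + z * (1 - x') * (1 - x) + x * (1 - z') * (1 - z)"
  proof -
    consider "j = int n + 1" | "j = - (int n + 1)" | "\<bar>j\<bar> \<le> int n" using j by linarith
    then show ?thesis
    proof cases
      case 1
      have "x = y ^ (2 * n + 2)" "z = 1" "x' = y ^ (2 * n + 1)"
        unfolding x_def z_def x'_def 1 by (simp_all add: nat_add_distrib nat_mult_distrib)
      then show ?thesis by simp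
    next
      case 2
      have "z = y ^ (2 * n + 2)" "x = 1" "z' = y ^ (2 * n + 1)"
        unfolding x_def z_def z'_def 2 by (simp_all add: nat_add_distrib nat_mult_distrib)
      then show ?thesis by simp
    next
      case 3
      have x: "x = y * x'" unfolding x_def x'_def power_Suc[symmetric]
        by (rule arg_cong[of _ _ "\<lambda>k. y ^ k"]) (use 3 in linarith)
      have z: "z = y * z'" unfolding z_def z'_def power_Suc[symmetric]
        by (rule arg_cong[of _ _ "\<lambda>k. y ^ k"]) (use 3 in linarith)
      have "x' * z' = y ^ (2 * n)" unfolding x'_def z'_def power_add[symmetric]
        by (rule arg_cong[of _ _ "\<lambda>k. y ^ k"]) (use 3 in linarith)
      then have y1: "y ^ (2 * n + 1) = y * (x' * z')" and y2: "y ^ (2 * n + 2) = y * (y * (x' * z'))"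
        by simp_all
      show ?thesis unfolding x z y1 y2 by algebra
    qed
  qed
  show ?thesis
    unfolding e1 e2 e3 e4 key p_def[symmetric] r_def[symmetric] x_def[symmetric] z_def[symmetric]
    by algebra
qed

text \<open>Consecutive triangular numbers differ by \<open>j\<close>, so the exponents of
  \<open>a\<close> and of \<open>b\<close> grow by the same amount, and a neighbouring term becomes
  the \<open>j\<close>-th one times a power of \<open>a * b\<close>.\<close>

lemma theta_term_pred:
  assumes "j \<le> int n + 1"
  shows "a * (a * b) ^ n * theta_term a b (j - 1) = theta_term a b j * (a * b) ^ nat (int n + 1 - j)"
proof -
  have "1 + n + tri (j - 1) = tri j + nat (int n + 1 - j)"
    using assms tri_pred[of j] by linarith
  then have 1: "a ^ (1 + n + tri (j - 1)) = a ^ (tri j + nat (int n + 1 - j))" by simp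
  have "n + tri (j - 1 - 1) = tri (j - 1) + nat (int n + 1 - j)"
    using assms tri_pred[of "j - 1"] by linarith
  then have 2: "b ^ (n + tri (j - 1 - 1)) = b ^ (tri (j - 1) + nat (int n + 1 - j))" by simp
  show ?thesis using arg_cong2[OF 1 2, of "(*)"]
    by (simp add: theta_term_def power_mult_distrib power_add mult_ac)
qed

lemma theta_term_succ:
  assumes "- j \<le> int n + 1"
  shows "b * (a * b) ^ n * theta_term a b (j + 1) = theta_term a b j * (a * b) ^ nat (int n + 1 + j)"
proof -
  have "- j - 1 = - (j + 1)" by simp
  then have "theta_term b a (- j - 1) = theta_term a b (j + 1)" by (simp only: theta_term_uminus)
  then show ?thesis
    using theta_term_pred[of "- j" n b a] assms
    by (simp add: theta_term_uminus mult.commute[of b a])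
qed

text \<open>After multiplication by \<open>qpoch (a * b) (2 * n)\<close> the coefficients are the
  Gaussian binomials of 2n over n + j. The induction step is \<open>triple_product_coeff_rec\<close>
  summed over \<open>j\<close>.\<close>

lemma finite_triple_product:
  assumes y: "(a * b) $ 0 = 0"
  shows "(\<Prod>i<n. (1 + a * (a * b) ^ i) * (1 + b * (a * b) ^ i)) * inverse (qpoch (a * b) (2 * n)) =
    (\<Sum>j\<in>{- int n..int n}. theta_term a b j *
       (inv_qpoch (a * b) (int n + j) * inv_qpoch (a * b) (int n - j)))"
proof (induction n)
  case 0
  then show ?case by (simp add: theta_term_def tri_def inv_qpoch_def)
next
  case (Suc n)
  define y where "y = a * b"
  have y0: "y $ 0 = 0" using y by (simp add: y_def)
  define F where "F = (\<lambda>j. theta_term a b j * (inv_qpoch y (int n + j) * inv_qpoch y (int n - j)))"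
  define c where "c = (1 - y ^ (2 * n + 1)) * (1 - y ^ (2 * n + 2))"
  let ?I = "{- int (Suc n)..int (Suc n)}"
  \<comment> \<open>Since \<open>F\<close> vanishes for \<open>\<bar>j\<bar> > int n\<close>, the
    enlarged range and its two shifts all give the same sum.\<close>
  have F0: "F j = 0" if "\<bar>j\<bar> > int n" for j
    using that by (auto simp: F_def inv_qpoch_def)
  have S0: "(\<Sum>j\<in>?I. F j) = (\<Sum>j\<in>{- int n..int n}. F j)"
    by (rule sum.mono_neutral_right) (auto intro!: F0)
  have Sm: "(\<Sum>j\<in>?I. F (j - 1)) = (\<Sum>j\<in>{- int n..int n}. F j)"
  proof -
    have "(\<Sum>j\<in>?I. F (j - 1)) = (\<Sum>j\<in>{- int n - 2..int n}. F j)"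
      by (rule sum.reindex_bij_witness[of _ "\<lambda>j. j + 1" "\<lambda>j. j - 1"]) auto
    also have "\<dots> = (\<Sum>j\<in>{- int n..int n}. F j)"
      by (rule sum.mono_neutral_right) (auto intro!: F0)
    finally show ?thesis .
  qed
  have Sp: "(\<Sum>j\<in>?I. F (j + 1)) = (\<Sum>j\<in>{- int n..int n}. F j)"
  proof -
    have "(\<Sum>j\<in>?I. F (j + 1)) = (\<Sum>j\<in>{- int n..int n + 2}. F j)"
      by (rule sum.reindex_bij_witness[of _ "\<lambda>j. j - 1" "\<lambda>j. j + 1"]) auto
    also have "\<dots> = (\<Sum>j\<in>{- int n..int n}. F j)"
      by (rule sum.mono_neutral_right) (auto intro!: F0)
    finally show ?thesis .
  qed
  have term_eq: "c * (theta_term a b j * (inv_qpoch y (int (Suc n) + j) * inv_qpoch y (int (Suc n) - j))) =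
      (1 + y ^ (2 * n + 1)) * F j + a * y ^ n * F (j - 1) + b * y ^ n * F (j + 1)"
    if "j \<in> ?I" for j
  proof -
    have j: "\<bar>j\<bar> \<le> int n + 1" using that by auto
    have 1: "a * y ^ n * F (j - 1) = theta_term a b j *
        (y ^ nat (int n + 1 - j) * (inv_qpoch y (int n + j - 1) * inv_qpoch y (int n + 1 - j)))"
    proof -
      have idx: "int n + (j - 1) = int n + j - 1" "int n - (j - 1) = int n + 1 - j" by simp_all
      have "a * y ^ n * theta_term a b (j - 1) = theta_term a b j * y ^ nat (int n + 1 - j)"
        using theta_term_pred[of j n a b] j by (simp add: y_def)
      then show ?thesis unfolding F_def idx by (simp only: mult.assoc[symmetric])
    qed
    have 2: "b * y ^ n * F (j + 1) = theta_term a b j *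
        (y ^ nat (int n + 1 + j) * (inv_qpoch y (int n + 1 + j) * inv_qpoch y (int n - j - 1)))"
    proof -
      have idx: "int n + (j + 1) = int n + 1 + j" "int n - (j + 1) = int n - j - 1" by simp_all
      have "b * y ^ n * theta_term a b (j + 1) = theta_term a b j * y ^ nat (int n + 1 + j)"
        using theta_term_succ[of j n b a] j by (simp add: y_def)
      then show ?thesis unfolding F_def idx by (simp only: mult.assoc[symmetric])
    qed
    show ?thesis
      unfolding 1 2 using arg_cong[OF triple_product_coeff_rec[OF y0 j], of "(*) (theta_term a b j)"]
      unfolding c_def F_def of_nat_Suc add.commute[of 1 "int n"]
      by (simp only: distrib_left mult_ac)
  qed
  have "c * (\<Sum>j\<in>?I. theta_term a b j * (inv_qpoch y (int (Suc n) + j) * inv_qpoch y (int (Suc n) - j)))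
      = (1 + y ^ (2 * n + 1)) * (\<Sum>j\<in>?I. F j) + a * y ^ n * (\<Sum>j\<in>?I. F (j - 1)) + b * y ^ n * (\<Sum>j\<in>?I. F (j + 1))"
    unfolding sum_distrib_left sum.distrib[symmetric] by (rule sum.cong[OF refl term_eq])
  also have "\<dots> = (1 + y ^ (2 * n + 1) + a * y ^ n + b * y ^ n) * (\<Sum>j\<in>{- int n..int n}. F j)"
    unfolding S0 Sm Sp by algebra
  also have "1 + y ^ (2 * n + 1) + a * y ^ n + b * y ^ n = (1 + a * y ^ n) * (1 + b * y ^ n)"
  proof -
    have "y ^ (2 * n + 1) = a * b * (y ^ n * y ^ n)" by (simp add: y_def[symmetric] mult_2 power_add)
    then show ?thesis by (simp add: algebra_simps)
  qed
  also have "(\<Sum>j\<in>{- int n..int n}. F j) =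
      (\<Prod>i<n. (1 + a * y ^ i) * (1 + b * y ^ i)) * inverse (qpoch y (2 * n))"
    using Suc.IH by (simp add: F_def y_def)
  also have "inverse (qpoch y (2 * n)) = c * inverse (qpoch y (2 * Suc n))"
    unfolding inverse_qpoch_Suc[OF y0, of "2 * n"] inverse_qpoch_Suc[OF y0, of "Suc (2 * n)"] c_def
    by (simp add: mult_ac)
  finally have "c * (\<Sum>j\<in>?I. theta_term a b j * (inv_qpoch y (int (Suc n) + j) * inv_qpoch y (int (Suc n) - j)))
     = c * ((\<Prod>i<Suc n. (1 + a * y ^ i) * (1 + b * y ^ i)) * inverse (qpoch y (2 * Suc n)))"
    by (simp add: mult_ac del: qpoch_Suc)
  moreover have "c $ 0 = 1" using y0 by (simp add: c_def)
  then have "c \<noteq> 0" by auto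
  ultimately show ?case by (simp add: y_def del: of_nat_Suc qpoch_Suc mult_Suc_right)
qed

text \<open>In the finite form multiplied by \<open>qpoch (a * b) (2 * n) * qpoch (a * b) n\<close>,
  each theta term has a coefficient \<open>c n j\<close> built from two finite products and two
  reciprocals. All converge to the same Euler product or its inverse, so \<open>c n j\<close> tends
  to 1 and \<open>theta_tannery\<close> applies.\<close>

theorem jacobi_triple_product:
  assumes y: "(a * b) $ 0 = 0"
  shows "(\<lambda>n. (\<Prod>i<n. (1 + a * (a * b) ^ i) * (1 + b * (a * b) ^ i)) * qpoch (a * b) n)
    \<longlonglongrightarrow> theta a b"
proof -
  define E where "E = (euler_E oo (a * b))"
  have E: "(\<lambda>n. qpoch (a * b) n) \<longlonglongrightarrow> E"
    unfolding E_def by (rule qpoch_tendsto_euler[OF y])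
  have E0: "E $ 0 = 1" by (simp add: E_def)
  define c where "c = (\<lambda>n j. qpoch (a * b) (2 * n) * qpoch (a * b) n *
     (inv_qpoch (a * b) (int n + j) * inv_qpoch (a * b) (int n - j)))"
  have lim: "(\<lambda>n. inv_qpoch (a * b) (int n + j)) \<longlonglongrightarrow> inverse E" for j
  proof -
    have "filterlim (\<lambda>n. nat (int n + j)) at_top sequentially"
      unfolding filterlim_at_top
    proof
      fix N
      show "eventually (\<lambda>n. N \<le> nat (int n + j)) sequentially"
        using eventually_ge_at_top[of "N + nat \<bar>j\<bar>"] by eventually_elim auto
    qed
    then have "(\<lambda>n. inverse (qpoch (a * b) (nat (int n + j)))) \<longlonglongrightarrow> inverse E"
      by (intro tendsto_inverse_fps filterlim_compose[OF E]) (simp_all add: E0)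
    moreover have "eventually (\<lambda>n. inverse (qpoch (a * b) (nat (int n + j))) =
        inv_qpoch (a * b) (int n + j)) sequentially"
      using eventually_ge_at_top[of "nat \<bar>j\<bar>"] by eventually_elim (auto simp: inv_qpoch_def)
    ultimately show ?thesis by (rule Lim_transform_eventually)
  qed
  have "(\<lambda>n. qpoch (a * b) (2 * n)) \<longlonglongrightarrow> E"
    by (rule filterlim_compose[OF E]) (simp add: mult_nat_left_at_top)
  then have "(\<lambda>n. c n j) \<longlonglongrightarrow> E * E * (inverse E * inverse E)" for j
    unfolding c_def using E lim[of j] lim[of "-j"] by (auto intro!: tendsto_mult_fps)
  moreover have "E * E * (inverse E * inverse E) = 1"
  proof -
    have "inverse E * E = 1" using E0 by (intro inverse_mult_eq_1) simp
    then show ?thesis by algebra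
  qed
  ultimately have c: "(\<lambda>n. c n j) \<longlonglongrightarrow> 1" for j by simp
  have "(\<Sum>j\<in>{- int n..int n}. theta_term a b j * c n j) =
     (\<Prod>i<n. (1 + a * (a * b) ^ i) * (1 + b * (a * b) ^ i)) * qpoch (a * b) n" for n
  proof -
    have "(\<Sum>j\<in>{- int n..int n}. theta_term a b j * c n j) =
       qpoch (a * b) (2 * n) * qpoch (a * b) n *
       ((\<Prod>i<n. (1 + a * (a * b) ^ i) * (1 + b * (a * b) ^ i)) * inverse (qpoch (a * b) (2 * n)))"
      unfolding finite_triple_product[OF y] sum_distrib_left c_def by (simp add: mult_ac)
    moreover have "inverse (qpoch (a * b) (2 * n)) * qpoch (a * b) (2 * n) = 1"
      by (rule inverse_mult_eq_1) (use y in \<open>simp add: qpoch_nth_0\<close>)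
    ultimately show ?thesis by algebra
  qed
  then show ?thesis using theta_tannery[of a b c, OF y c] by simp
qed

subsection \<open>Product evaluations and the 3-dissection of theta series\<close>

lemma qpoch_add: "qpoch y (n + k) = qpoch y n * (\<Prod>r<k. 1 - y ^ Suc (n + r))"
  by (induction k) (simp_all add: mult_ac)

text \<open>Groups the factors by the residue of the index modulo \<open>k\<close>. Products for
  different \<open>m\<close> but equal \<open>m * k\<close> can then be compared factor by factor in
  \<open>i\<close>.\<close>

lemma qpoch_mult: "qpoch (y ^ m) (k * n) = (\<Prod>i<n. \<Prod>r<k. 1 - y ^ (m * Suc r) * (y ^ (m * k)) ^ i)"
proof (induction n)
  case (Suc n)
  have "y ^ (m * Suc r) * (y ^ (m * k)) ^ n = (y ^ m) ^ Suc (k * n + r)" for r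
    unfolding power_mult[symmetric] power_add[symmetric] by (simp add: algebra_simps)
  then show ?case
    using Suc qpoch_add[of "y ^ m" "k * n" k] by (simp add: add.commute)
qed simp

lemma qpoch_mult_tendsto:
  assumes "y $ 0 = 0" "m > 0" "k > 0"
  shows "(\<lambda>n. qpoch (y ^ m) (k * n)) \<longlonglongrightarrow> (euler_E oo y ^ m)"
proof -
  have "filterlim (\<lambda>n. k * n) at_top sequentially"
    using assms by (simp add: mult_nat_left_at_top)
  moreover have "(y ^ m) $ 0 = 0" using assms by simp
  ultimately show ?thesis by (intro filterlim_compose[OF qpoch_tendsto_euler])
qed

text \<open>The triple product supplies the odd exponents twice and the even ones once; one more
  copy of the even ones completes a square. The identity holds for the finite products and passes to
  the limit, as in the next two lemmas.\<close>

lemma theta_phi_product: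
  assumes y: "y $ 0 = 0"
  shows "theta (- y) (- y) * (euler_E oo y ^ 2) = (euler_E oo y) ^ 2"
proof -
  have ab: "- y * - y = y ^ 2" by (simp add: power2_eq_square)
  let ?P = "\<lambda>n. (\<Prod>i<n. (1 + - y * (y ^ 2) ^ i) * (1 + - y * (y ^ 2) ^ i)) * qpoch (y ^ 2) n"
  have "?P n * qpoch (y ^ 2) (1 * n) = qpoch (y ^ 1) (2 * n) ^ 2" for n
  proof -
    have "qpoch (y ^ 2) n = qpoch (y ^ 2) (1 * n)" by simp
    then show ?thesis
      unfolding power2_eq_square[of "qpoch _ _"]
      by (simp only: qpoch_mult prod.distrib[symmetric])
        (rule prod.cong, simp_all add: eval_nat_numeral mult_ac)
  qed
  moreover have "?P \<longlonglongrightarrow> theta (- y) (- y)"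
    using jacobi_triple_product[of "- y" "- y"] y unfolding ab by simp
  from tendsto_mult_fps[OF this qpoch_mult_tendsto[OF y, of 2 1]]
  have "(\<lambda>n. ?P n * qpoch (y ^ 2) (1 * n)) \<longlonglongrightarrow> theta (- y) (- y) * (euler_E oo y ^ 2)"
    by simp
  moreover have "(\<lambda>n. qpoch (y ^ 1) (2 * n) ^ 2) \<longlonglongrightarrow> (euler_E oo y ^ 1) ^ 2"
    by (intro tendsto_power_fps qpoch_mult_tendsto y) simp_all
  ultimately show ?thesis using LIMSEQ_unique by fastforce
qed

text \<open>Count exponents modulo 6: the theta series gives 1, 5, 6, the other two products give 2,
  4, 6 and 3, 6. Together this is every residue once and 6 two more times.\<close>

lemma theta_omega_product:
  assumes y: "y $ 0 = 0"
  shows "theta (- y) (- (y ^ 5)) * ((euler_E oo y ^ 2) * (euler_E oo y ^ 3)) =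
    (euler_E oo y) * (euler_E oo y ^ 6) ^ 2"
proof -
  have ab: "- y * - (y ^ 5) = y ^ 6" by (simp add: eval_nat_numeral)
  let ?P = "\<lambda>n. (\<Prod>i<n. (1 + - y * (y ^ 6) ^ i) * (1 + - (y ^ 5) * (y ^ 6) ^ i)) * qpoch (y ^ 6) n"
  have "?P n * (qpoch (y ^ 2) (3 * n) * qpoch (y ^ 3) (2 * n)) =
      qpoch (y ^ 1) (6 * n) * qpoch (y ^ 6) (1 * n) ^ 2" for n
  proof -
    have "qpoch (y ^ 6) n = qpoch (y ^ 6) (1 * n)" by simp
    then show ?thesis
      unfolding power2_eq_square[of "qpoch _ _"]
      by (simp only: qpoch_mult prod.distrib[symmetric])
        (rule prod.cong, simp_all add: eval_nat_numeral mult_ac)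
  qed
  moreover have "?P \<longlonglongrightarrow> theta (- y) (- (y ^ 5))"
    using jacobi_triple_product[of "- y" "- (y ^ 5)"] y unfolding ab by simp
  then have "(\<lambda>n. ?P n * (qpoch (y ^ 2) (3 * n) * qpoch (y ^ 3) (2 * n))) \<longlonglongrightarrow>
      theta (- y) (- (y ^ 5)) * ((euler_E oo y ^ 2) * (euler_E oo y ^ 3))"
    by (intro tendsto_mult_fps qpoch_mult_tendsto y) simp_all
  moreover have "(\<lambda>n. qpoch (y ^ 1) (6 * n) * qpoch (y ^ 6) (1 * n) ^ 2) \<longlonglongrightarrow>
      (euler_E oo y ^ 1) * (euler_E oo y ^ 6) ^ 2"
    by (intro tendsto_mult_fps tendsto_power_fps qpoch_mult_tendsto y) simp_all
  ultimately show ?thesis using LIMSEQ_unique by fastforce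
qed

lemma theta_A_product:
  assumes y: "y $ 0 = 0"
  shows "theta y (y ^ 2) * ((euler_E oo y) * (euler_E oo y ^ 6)) =
    (euler_E oo y ^ 2) * (euler_E oo y ^ 3) ^ 2"
proof -
  have ab: "y * y ^ 2 = y ^ 3" by (simp add: eval_nat_numeral)
  let ?P = "\<lambda>n. (\<Prod>i<n. (1 + y * (y ^ 3) ^ i) * (1 + y ^ 2 * (y ^ 3) ^ i)) * qpoch (y ^ 3) n"
  have "?P n * (qpoch (y ^ 1) (3 * n) * qpoch (y ^ 6) (1 * n)) =
      qpoch (y ^ 2) (3 * n) * qpoch (y ^ 3) (1 * n) ^ 2" for n
  proof -
    have q: "qpoch (y ^ 3) n = qpoch (y ^ 3) (1 * n)" by simp
    \<comment> \<open>The \<open>i\<close>-th factors with \<open>z = (y ^ 3) ^ i\<close>: each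
      factor with a plus sign meets its partner through (1 + t)(1 - t) = 1 - t^2.\<close>
    have "(1 + y * z) * (1 + y ^ 2 * z) * (1 - y ^ 3 * z) * ((1 - y * z) * (1 - y ^ 2 * z) * (1 - y ^ 3 * z) * (1 - y ^ 6 * z ^ 2))
      = (1 - y ^ 2 * z ^ 2) * (1 - y ^ 4 * z ^ 2) * (1 - y ^ 6 * z ^ 2) * ((1 - y ^ 3 * z) * (1 - y ^ 3 * z))" for z
      by algebra
    moreover have "(y ^ 6) ^ i = ((y ^ 3) ^ i) ^ 2" for i
      unfolding power_mult[symmetric] by (simp add: mult_ac)
    ultimately have *: "(1 + y * (y ^ 3) ^ i) * (1 + y ^ 2 * (y ^ 3) ^ i) * (1 - y ^ 3 * (y ^ 3) ^ i) *
        ((1 - y * (y ^ 3) ^ i) * (1 - y ^ 2 * (y ^ 3) ^ i) * (1 - y ^ 3 * (y ^ 3) ^ i) * (1 - y ^ 6 * (y ^ 6) ^ i))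
      = (1 - y ^ 2 * (y ^ 6) ^ i) * (1 - y ^ 4 * (y ^ 6) ^ i) * (1 - y ^ 6 * (y ^ 6) ^ i) * ((1 - y ^ 3 * (y ^ 3) ^ i) * (1 - y ^ 3 * (y ^ 3) ^ i))" for i
      by simp
    show ?thesis
      unfolding power2_eq_square[of "qpoch _ _"] q
      unfolding qpoch_mult prod.distrib[symmetric]
    proof (rule prod.cong[OF refl], goal_cases)
      case (1 i)
      show ?case using *[of i] by (simp add: eval_nat_numeral mult_ac)
    qed
  qed
  moreover have "?P \<longlonglongrightarrow> theta y (y ^ 2)"
    using jacobi_triple_product[of y "y ^ 2"] y unfolding ab by simp
  then have "(\<lambda>n. ?P n * (qpoch (y ^ 1) (3 * n) * qpoch (y ^ 6) (1 * n))) \<longlonglongrightarrow>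
      theta y (y ^ 2) * ((euler_E oo y ^ 1) * (euler_E oo y ^ 6))"
    by (intro tendsto_mult_fps qpoch_mult_tendsto y) simp_all
  moreover have "(\<lambda>n. qpoch (y ^ 2) (3 * n) * qpoch (y ^ 3) (1 * n) ^ 2) \<longlonglongrightarrow>
      (euler_E oo y ^ 2) * (euler_E oo y ^ 3) ^ 2"
    by (intro tendsto_mult_fps tendsto_power_fps qpoch_mult_tendsto y) simp_all
  ultimately show ?thesis using LIMSEQ_unique by fastforce
qed

text \<open>The 2 is the factor \<open>1 + y ^ 0\<close>. Moving it out shifts the product by one
  and leaves \<open>1 + y ^ n\<close>, which tends to 1.\<close>

lemma theta_psi_product:
  assumes y: "y $ 0 = 0"
  shows "theta 1 y * (euler_E oo y) = 2 * (euler_E oo y ^ 2) ^ 2"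
proof -
  let ?P = "\<lambda>n. (\<Prod>i<n. (1 + 1 * y ^ i) * (1 + y * y ^ i)) * qpoch y n"
  have tele: "(1 + y ^ n) * (\<Prod>i<n. 1 + y ^ i) = 2 * (\<Prod>i<n. 1 + y * y ^ i)" for n
  proof (induction n)
    case (Suc n)
    have "(1 + y ^ Suc n) * (\<Prod>i<Suc n. 1 + y ^ i) = (1 + y ^ Suc n) * ((1 + y ^ n) * (\<Prod>i<n. 1 + y ^ i))"
      by simp
    also have "\<dots> = 2 * (\<Prod>i<Suc n. 1 + y * y ^ i)" unfolding Suc by simp
    finally show ?case .
  qed simp
  have "(1 + y ^ n) * ?P n * qpoch y n = 2 * qpoch (y ^ 2) n ^ 2" for n
  proof -
    have "(1 + y ^ n) * ?P n * qpoch y n =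
       ((1 + y ^ n) * (\<Prod>i<n. 1 + y ^ i)) * ((\<Prod>i<n. 1 + y * y ^ i) * (qpoch y n * qpoch y n))"
      by (simp add: prod.distrib mult_ac)
    also have "\<dots> = 2 * ((\<Prod>i<n. 1 + y * y ^ i) * qpoch y n) ^ 2"
      unfolding tele by (simp add: power2_eq_square mult_ac)
    also have "(\<Prod>i<n. 1 + y * y ^ i) * qpoch y n = qpoch (y ^ 2) n"
      unfolding qpoch_def prod.distrib[symmetric]
      by (rule prod.cong[OF refl]) (simp add: power_mult_distrib power2_eq_square algebra_simps)
    finally show ?thesis .
  qed
  moreover have "?P \<longlonglongrightarrow> theta 1 y"
    using jacobi_triple_product[of 1 y] y by simp
  then have "(\<lambda>n. (1 + y ^ n) * ?P n * qpoch y n) \<longlonglongrightarrow> (1 + 0) * theta 1 y * (euler_E oo y)"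
    by (intro tendsto_mult_fps tendsto_add_fps tendsto_const tendsto_power_0_fps
        qpoch_tendsto_euler y)
  moreover have "(\<lambda>n. 2 * qpoch (y ^ 2) n ^ 2) \<longlonglongrightarrow> 2 * (euler_E oo y ^ 2) ^ 2"
    by (intro tendsto_mult_fps tendsto_const tendsto_power_fps qpoch_tendsto_euler) (simp add: y)
  ultimately show ?thesis using LIMSEQ_unique by fastforce
qed

section \<open>Splitting two-sided theta series modulo 3\<close>

lemma sum_symmetric_Suc:
  "(\<Sum>j\<in>{- int (Suc n)..int (Suc n)}. f j) =
    (\<Sum>j\<in>{- int n..int n}. f j) + f (int (Suc n)) + f (- int (Suc n))" for f :: "int \<Rightarrow> 'a :: comm_monoid_add"
proof -
  have "{- int (Suc n)..int (Suc n)} = insert (- int (Suc n)) (insert (int (Suc n)) {- int n..int n})"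
    by auto
  then show ?thesis by (simp add: add_ac)
qed

lemma sum_symmetric_mod3:
  "(\<Sum>j\<in>{- int (3 * n + 1)..int (3 * n + 1)}. f j) =
    (\<Sum>j\<in>{- int n..int n}. f (3 * j) + f (3 * j + 1) + f (3 * j - 1))" for f :: "int \<Rightarrow> 'a :: comm_monoid_add"
proof (induction n)
  case 0
  have "{- 1..1::int} = {- 1, 0, 1}" by auto
  then show ?case by (simp add: add_ac)
next
  case (Suc n)
  have "3 * Suc n + 1 = Suc (Suc (Suc (3 * n + 1)))" by simp
  then show ?case
    unfolding sum_symmetric_Suc Suc.IH by (simp only: sum_symmetric_Suc Suc.IH) (simp add: add_ac)
qed

text \<open>Split the index into 3m, 3m + 1 and 3m - 1; this choice of residues keeps the ranges
  symmetric. In each class the exponents are linear in \<open>tri m\<close> and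
  \<open>tri (m - 1)\<close>, so each subseries is again a theta series.\<close>

lemma theta_dissection:
  assumes ab: "(a * b) $ 0 = 0"
  shows "theta a b = theta (a ^ 6 * b ^ 3) (a ^ 3 * b ^ 6) + a * theta (a ^ 9 * b ^ 6) (b ^ 3) +
    b * theta (a ^ 3) (a ^ 6 * b ^ 9)"
proof -
  have q: "(a ^ 6 * b ^ 3 * (a ^ 3 * b ^ 6)) $ 0 = 0" "(a ^ 9 * b ^ 6 * b ^ 3) $ 0 = 0"
    "(a ^ 3 * (a ^ 6 * b ^ 9)) $ 0 = 0"
    using ab by auto
  have t0: "theta_term a b (3 * m) = theta_term (a ^ 6 * b ^ 3) (a ^ 3 * b ^ 6) m" for m
  proof -
    have "int (tri (3 * m)) = int (6 * tri m + 3 * tri (m - 1))"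
      "int (tri (3 * m - 1)) = int (3 * tri m + 6 * tri (m - 1))"
      using two_tri[of "3 * m"] two_tri[of m] two_tri[of "m - 1"] two_tri[of "3 * m - 1"]
      by (simp_all add: algebra_simps)
    then have "tri (3 * m) = 6 * tri m + 3 * tri (m - 1)" "tri (3 * m - 1) = 3 * tri m + 6 * tri (m - 1)"
      by (simp_all only: of_nat_eq_iff)
    then show ?thesis
      by (simp add: theta_term_def power_mult_distrib power_add power_mult[symmetric] mult_ac)
  qed
  have t1: "theta_term a b (3 * m + 1) = a * theta_term (a ^ 9 * b ^ 6) (b ^ 3) m" for m
  proof -
    have "int (tri (3 * m + 1)) = int (1 + 9 * tri m)"
      "int (tri (3 * m)) = int (6 * tri m + 3 * tri (m - 1))"
      using two_tri[of "3 * m"] two_tri[of m] two_tri[of "m - 1"] two_tri[of "3 * m + 1"]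
      by (simp_all add: algebra_simps)
    then have "tri (3 * m + 1) = 1 + 9 * tri m" "tri (3 * m) = 6 * tri m + 3 * tri (m - 1)"
      by (simp_all only: of_nat_eq_iff)
    then show ?thesis
      by (simp add: theta_term_def power_mult_distrib power_add power_mult[symmetric] mult_ac)
  qed
  have t2: "theta_term a b (3 * m - 1) = b * theta_term (a ^ 3) (a ^ 6 * b ^ 9) m" for m
  proof -
    have "int (tri (3 * m - 1 - 1)) = int (1 + 9 * tri (m - 1))"
      "int (tri (3 * m - 1)) = int (3 * tri m + 6 * tri (m - 1))"
      using two_tri[of "3 * m - 1"] two_tri[of m] two_tri[of "m - 1"] two_tri[of "3 * m - 1 - 1"]
      by (simp_all add: algebra_simps)
    then have "tri (3 * m - 1 - 1) = 1 + 9 * tri (m - 1)" "tri (3 * m - 1) = 3 * tri m + 6 * tri (m - 1)"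
      by (simp_all only: of_nat_eq_iff)
    then show ?thesis
      unfolding theta_term_def by (simp add: power_mult_distrib power_add power_mult[symmetric] mult_ac)
  qed
  have "(\<lambda>n. \<Sum>j\<in>{- int (3 * n + 1)..int (3 * n + 1)}. theta_term a b j) \<longlonglongrightarrow> theta a b"
    by (rule filterlim_compose[OF theta_tendsto[OF ab]])
      (rule filterlim_subseq, simp add: strict_mono_def)
  moreover have "(\<Sum>j\<in>{- int (3 * n + 1)..int (3 * n + 1)}. theta_term a b j) =
      (\<Sum>j\<in>{- int n..int n}. theta_term (a ^ 6 * b ^ 3) (a ^ 3 * b ^ 6) j) +
      a * (\<Sum>j\<in>{- int n..int n}. theta_term (a ^ 9 * b ^ 6) (b ^ 3) j) +
      b * (\<Sum>j\<in>{- int n..int n}. theta_term (a ^ 3) (a ^ 6 * b ^ 9) j)" for n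
    unfolding sum_symmetric_mod3 t0 t1 t2 by (simp add: sum.distrib sum_distrib_left)
  moreover have "(\<lambda>n. (\<Sum>j\<in>{- int n..int n}. theta_term (a ^ 6 * b ^ 3) (a ^ 3 * b ^ 6) j) +
      a * (\<Sum>j\<in>{- int n..int n}. theta_term (a ^ 9 * b ^ 6) (b ^ 3) j) +
      b * (\<Sum>j\<in>{- int n..int n}. theta_term (a ^ 3) (a ^ 6 * b ^ 9) j)) \<longlonglongrightarrow>
     theta (a ^ 6 * b ^ 3) (a ^ 3 * b ^ 6) + a * theta (a ^ 9 * b ^ 6) (b ^ 3) +
     b * theta (a ^ 3) (a ^ 6 * b ^ 9)"
    by (intro tendsto_add_fps tendsto_mult_fps tendsto_const theta_tendsto q)
  ultimately show ?thesis using LIMSEQ_unique by fastforce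
qed

subsection \<open>Sections modulo 3 and the cubic norm\<close>

definition section3 :: "nat \<Rightarrow> rat fps \<Rightarrow> rat fps" where
  "section3 r f = Abs_fps (\<lambda>n. f $ (3 * n + r))"

abbreviation cube_subst :: "rat fps \<Rightarrow> rat fps" where
  "cube_subst f \<equiv> f oo fps_X ^ 3"

lemma fps_nth_compose_fps_X_power:
  fixes f :: "'a :: comm_ring_1 fps"
  assumes "m > 0"
  shows "(f oo fps_X ^ m) $ n = (if m dvd n then f $ (n div m) else 0)"
proof -
  have "(f oo fps_X ^ m) $ n = (\<Sum>i=0..n. if n = m * i then f $ i else 0)"
    unfolding fps_compose_nth power_mult[symmetric] by (intro sum.cong) auto
  also have "\<dots> = (if m dvd n then f $ (n div m) else 0)"
  proof (cases "m dvd n")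
    case True
    then obtain k where k: "n = m * k" by blast
    then have "(\<Sum>i=0..n. if n = m * i then f $ i else 0) = (\<Sum>i=0..n. if k = i then f $ i else 0)"
      using assms by (intro sum.cong) auto
    then show ?thesis using k assms by (auto simp: sum.delta)
  next
    case False
    then show ?thesis by (auto intro!: sum.neutral)
  qed
  finally show ?thesis .
qed

lemma cube_subst_simps:
  "cube_subst (f + h) = cube_subst f + cube_subst h"
  "cube_subst (f - h) = cube_subst f - cube_subst h"
  "cube_subst (- f) = - cube_subst f"
  "cube_subst (f * h) = cube_subst f * cube_subst h"
  "cube_subst (f ^ n) = cube_subst f ^ n"
  "cube_subst (numeral k) = numeral k"
  "cube_subst fps_X = fps_X ^ 3"
  by (simp_all add: fps_compose_add_distrib fps_compose_sub_distrib fps_compose_uminus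
      fps_compose_mult_distrib fps_compose_power fps_numeral_fps_const)

lemma section3_add: "section3 r (f + h) = section3 r f + section3 r h"
  by (simp add: fps_eq_iff section3_def)

text \<open>Uniqueness of the decomposition by residues modulo 3. All later sections are read off
  decompositions of this shape.\<close>

lemma section3_dissection:
  "section3 0 (cube_subst a + fps_X * cube_subst b + fps_X ^ 2 * cube_subst c) = a"
  "section3 1 (cube_subst a + fps_X * cube_subst b + fps_X ^ 2 * cube_subst c) = b"
  "section3 2 (cube_subst a + fps_X * cube_subst b + fps_X ^ 2 * cube_subst c) = c"
proof -
  have d: "3 dvd 3 * n - Suc 0 \<longleftrightarrow> n = 0" "3 dvd 3 * n - 2 \<longleftrightarrow> n = 0"
    "\<not> 3 dvd Suc (3 * n)" "\<not> 3 dvd Suc (Suc (3 * n))" for n :: nat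
    by presburger+
  show "section3 0 (cube_subst a + fps_X * cube_subst b + fps_X ^ 2 * cube_subst c) = a"
    "section3 1 (cube_subst a + fps_X * cube_subst b + fps_X ^ 2 * cube_subst c) = b"
    "section3 2 (cube_subst a + fps_X * cube_subst b + fps_X ^ 2 * cube_subst c) = c"
    by (auto simp: fps_eq_iff section3_def fps_X_power_mult_nth fps_nth_compose_fps_X_power d)
qed

lemma dissect3:
  "f = cube_subst (section3 0 f) + fps_X * cube_subst (section3 1 f) + fps_X ^ 2 * cube_subst (section3 2 f)"
  (is "f = ?R")
proof (rule fps_ext)
  fix n :: nat
  have "n = 3 * (n div 3) \<or> n = 3 * (n div 3) + 1 \<or> n = 3 * (n div 3) + 2" by presburger
  then consider k where "n = 3 * k" | k where "n = 3 * k + 1" | k where "n = 3 * k + 2" by blast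
  then show "f $ n = ?R $ n"
  proof cases
    case 1
    have "?R $ n = section3 0 ?R $ k" by (simp add: section3_def 1)
    then show ?thesis unfolding section3_dissection by (simp add: section3_def 1)
  next
    case 2
    have "?R $ n = section3 1 ?R $ k" by (simp add: section3_def 2)
    then show ?thesis unfolding section3_dissection by (simp add: section3_def 2)
  next
    case 3
    have "?R $ n = section3 2 ?R $ k" by (simp add: section3_def 3)
    then show ?thesis unfolding section3_dissection by (simp add: section3_def 3)
  qed
qed

text \<open>Residues add modulo 3, and a carry contributes the factor \<open>fps_X\<close>.\<close>

lemma section3_mult:
  "section3 0 (f * h) = section3 0 f * section3 0 h +
     fps_X * (section3 1 f * section3 2 h + section3 2 f * section3 1 h)"
  "section3 1 (f * h) = section3 0 f * section3 1 h + section3 1 f * section3 0 h +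
     fps_X * (section3 2 f * section3 2 h)"
  "section3 2 (f * h) = section3 0 f * section3 2 h + section3 1 f * section3 1 h +
     section3 2 f * section3 0 h"
proof -
  define f0 f1 f2 h0 h1 h2 where fs: "f0 = section3 0 f" "f1 = section3 1 f" "f2 = section3 2 f"
    "h0 = section3 0 h" "h1 = section3 1 h" "h2 = section3 2 h"
  have f: "f = cube_subst f0 + fps_X * cube_subst f1 + fps_X ^ 2 * cube_subst f2"
    unfolding fs by (rule dissect3)
  have h: "h = cube_subst h0 + fps_X * cube_subst h1 + fps_X ^ 2 * cube_subst h2"
    unfolding fs by (rule dissect3)
  have "f * h = cube_subst (f0 * h0 + fps_X * (f1 * h2 + f2 * h1)) +
      fps_X * cube_subst (f0 * h1 + f1 * h0 + fps_X * (f2 * h2)) +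
      fps_X ^ 2 * cube_subst (f0 * h2 + f1 * h1 + f2 * h0)"
    unfolding f h cube_subst_simps by algebra
  then show "section3 0 (f * h) = section3 0 f * section3 0 h +
     fps_X * (section3 1 f * section3 2 h + section3 2 f * section3 1 h)"
  "section3 1 (f * h) = section3 0 f * section3 1 h + section3 1 f * section3 0 h +
     fps_X * (section3 2 f * section3 2 h)"
  "section3 2 (f * h) = section3 0 f * section3 2 h + section3 1 f * section3 1 h +
     section3 2 f * section3 0 h"
    by (simp_all only: section3_dissection fs)
qed

lemma section3_cube_subst:
  "section3 0 (cube_subst f) = f" "section3 1 (cube_subst f) = 0" "section3 2 (cube_subst f) = 0"
  using section3_dissection[of f 0 0] by simp_all

lemma section3_cube_subst_mult:
  assumes "r < 3"
  shows "section3 r (cube_subst f * h) = f * section3 r h"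
proof -
  have "r = 0 \<or> r = 1 \<or> r = 2" using assms by auto
  then show ?thesis by (auto simp: section3_mult section3_cube_subst simp del: One_nat_def)
qed

lemma section3_tendsto:
  assumes "(f \<longlongrightarrow> a) F"
  shows "((\<lambda>x. section3 r (f x)) \<longlongrightarrow> section3 r a) F"
  using assms by (auto simp: tendsto_fps_iff section3_def)

text \<open>Up to substituting \<open>q\<^sup>3\<close> for \<open>q\<close>, this is \<open>f(q) f(\<zeta>q) f(\<zeta>\<^sup>2q)\<close> for a primitive cube root of unity \<open>\<zeta>\<close>.\<close>

definition norm3 :: "rat fps \<Rightarrow> rat fps" where
  "norm3 f = section3 0 f ^ 3 + fps_X * section3 1 f ^ 3 + fps_X ^ 2 * section3 2 f ^ 3
     + (- 3) * fps_X * section3 0 f * section3 1 f * section3 2 f"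

text \<open>Once the sections of the product are inserted, multiplicativity is a polynomial identity
  over \<open>rat\<close>, so cube roots of unity stay out of the argument.\<close>

lemma norm3_mult: "norm3 (f * h) = norm3 f * norm3 h"
  unfolding norm3_def section3_mult by algebra

lemma norm3_power: "norm3 (f ^ n) = norm3 f ^ n"
proof (induction n)
  case 0
  have "section3 0 1 = 1" "section3 1 1 = 0" "section3 2 1 = 0"
    using section3_cube_subst[of 1] by simp_all
  then show ?case by (simp add: norm3_def del: One_nat_def)
qed (simp add: norm3_mult)

lemma norm3_tendsto:
  assumes "(f \<longlongrightarrow> a) F"
  shows "((\<lambda>x. norm3 (f x)) \<longlongrightarrow> norm3 a) F"
  unfolding norm3_def
  by (intro tendsto_add_fps tendsto_mult_fps tendsto_power_fps tendsto_const section3_tendsto assms)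

lemma norm3_dissection:
  "norm3 (cube_subst a + fps_X * cube_subst b + fps_X ^ 2 * cube_subst c) =
     a ^ 3 + fps_X * b ^ 3 + fps_X ^ 2 * c ^ 3 - 3 * fps_X * a * b * c"
  unfolding norm3_def section3_dissection by simp

lemma norm3_one_minus_power_cube: "norm3 (1 - fps_X ^ (3 * k)) = (1 - fps_X ^ k) ^ 3"
  using norm3_dissection[of "1 - fps_X ^ k" 0 0]
  by (simp add: cube_subst_simps fps_compose_sub_distrib power_mult)

text \<open>For \<open>k\<close> prime to 3 the three conjugates of 1 - q^k multiply to 1 - q^(3k),
  and q^3 is then renamed q. If 3 divides the exponent, the conjugates coincide and a cube appears
  instead.\<close>

lemma norm3_one_minus_power:
  assumes "\<not> 3 dvd k"
  shows "norm3 (1 - fps_X ^ k) = 1 - fps_X ^ k"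
proof -
  have "k = 3 * (k div 3) + 1 \<or> k = 3 * (k div 3) + 2" using assms by presburger
  then obtain i where i: "k = 3 * i + 1 \<or> k = 3 * i + 2" by blast
  have V: "cube_subst (- (fps_X ^ i)) = - (fps_X ^ (3 * i))"
    by (simp add: cube_subst_simps power_mult)
  from i show ?thesis
  proof
    assume k: "k = 3 * i + 1"
    show ?thesis using norm3_dissection[of 1 "- (fps_X ^ i)" 0] unfolding V k
      by (simp add: power_mult[symmetric] mult.commute)
  next
    assume k: "k = 3 * i + 2"
    show ?thesis using norm3_dissection[of 1 0 "- (fps_X ^ i)"] unfolding V k
      by (simp add: power_mult[symmetric] mult.commute power2_eq_square mult.assoc)
  qed
qed

text \<open>As 3 does not divide \<open>m\<close>, the factors of E(q^m) with index prime to 3 are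
  kept and give E(q^m)/E(q^(3m)); those with index 3l become (1 - q^(ml))^3 and give E(q^m)^3. The
  finite version takes three factors at a time.\<close>

lemma norm3_euler_Em:
  assumes "\<not> 3 dvd m"
  shows "norm3 (euler_Em m) * euler_Em (3 * m) = euler_Em m ^ 4"
proof -
  define y where "y = (fps_X ^ m :: rat fps)"
  have m: "m > 0" using assms by (intro gr0I) auto
  then have y0: "y $ 0 = 0" by (simp add: y_def)
  have fin: "norm3 (qpoch (y ^ 1) (3 * n)) * qpoch (y ^ 3) (1 * n) = qpoch (y ^ 1) (3 * n) * qpoch (y ^ 1) (1 * n) ^ 3" for n
  proof (induction n)
    case 0
    then show ?case using norm3_power[of 1 0] by simp
  next
    case (Suc n)
    have 3: "3 * Suc n = Suc (Suc (Suc (3 * n)))" by simp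
    have nd: "\<not> 3 dvd m * Suc (3 * n)" "\<not> 3 dvd m * Suc (Suc (3 * n))"
    proof -
      have "prime (3::nat)" by simp
      moreover have "\<not> 3 dvd Suc (3 * n)" "\<not> 3 dvd Suc (Suc (3 * n))" by presburger+
      ultimately show "\<not> 3 dvd m * Suc (3 * n)" "\<not> 3 dvd m * Suc (Suc (3 * n))"
        using assms prime_dvd_multD by blast+
    qed
    define z1 z2 z3 z4 where z: "z1 = 1 - y ^ Suc (3 * n)" "z2 = 1 - y ^ Suc (Suc (3 * n))"
      "z3 = 1 - y ^ Suc n" "z4 = 1 - y ^ Suc (Suc (Suc (3 * n)))"
    have n1: "norm3 z1 = z1" "norm3 z2 = z2"
      unfolding z y_def power_mult[symmetric] using norm3_one_minus_power nd by blast+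
    have z3': "1 - y ^ Suc (Suc (Suc (3 * n))) = 1 - fps_X ^ (3 * (m * Suc n))"
      unfolding y_def power_mult[symmetric] by (simp add: algebra_simps)
    have n3: "norm3 (1 - y ^ Suc (Suc (Suc (3 * n)))) = z3 ^ 3"
      unfolding z3' norm3_one_minus_power_cube by (simp only: z y_def power_mult)
    have c3: "1 - (y ^ 3) ^ Suc n = 1 - y ^ Suc (Suc (Suc (3 * n)))"
      unfolding power_mult[symmetric] 3 ..
    have n4: "norm3 z4 = z3 ^ 3" using n3 by (simp only: z)
    show ?case
      using Suc.IH
      by (simp only: 3 qpoch_Suc power_one_right mult_1 c3 norm3_mult z[symmetric] n1 n4) algebra
  qed
  have "(\<lambda>n. norm3 (qpoch (y ^ 1) (3 * n)) * qpoch (y ^ 3) (1 * n)) \<longlonglongrightarrow> norm3 (euler_E oo y ^ 1) * (euler_E oo y ^ 3)"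
    by (intro tendsto_mult_fps norm3_tendsto qpoch_mult_tendsto y0) simp_all
  moreover have "(\<lambda>n. qpoch (y ^ 1) (3 * n) * qpoch (y ^ 1) (1 * n) ^ 3) \<longlonglongrightarrow> (euler_E oo y ^ 1) * (euler_E oo y ^ 1) ^ 3"
    by (intro tendsto_mult_fps tendsto_power_fps qpoch_mult_tendsto y0) simp_all
  ultimately have "norm3 (euler_E oo y ^ 1) * (euler_E oo y ^ 3) = (euler_E oo y ^ 1) * (euler_E oo y ^ 1) ^ 3"
    unfolding fin using LIMSEQ_unique by blast
  then show ?thesis
    by (simp add: euler_Em_def y_def power_add eval_nat_numeral)
qed

lemma theta_compose:
  assumes ab: "(a * b) $ 0 = 0" and y: "y $ 0 = 0"
  shows "theta a b oo y = theta (a oo y) (b oo y)"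
proof -
  have "(\<Sum>j\<in>{- int n..int n}. theta_term a b j) oo y =
      (\<Sum>j\<in>{- int n..int n}. theta_term (a oo y) (b oo y) j)" for n
    by (simp add: fps_compose_sum_distrib theta_term_def fps_compose_mult_distrib fps_compose_power y)
  moreover have "((a oo y) * (b oo y)) $ 0 = 0"
    using ab by simp
  ultimately show ?thesis
    using tendsto_compose_fps[OF theta_tendsto[OF ab], of y] theta_tendsto[of "a oo y" "b oo y"]
    by (simp add: LIMSEQ_unique)
qed

subsection \<open>Parametrization by \<open>u\<close>\<close>

lemma euler_Em_nth_0 [simp]: "euler_Em m $ 0 = 1"
  by (simp add: euler_Em_def)

lemma euler_Em_nonzero [simp]: "euler_Em m \<noteq> 0"
  using euler_Em_nth_0[of m] by (metis fps_zero_nth zero_neq_one)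

lemma cube_subst_euler_Em:
  assumes "m > 0"
  shows "cube_subst (euler_Em m) = euler_Em (3 * m)"
proof -
  have "euler_E oo (fps_X ^ m oo fps_X ^ 3) = cube_subst (euler_E oo fps_X ^ m)"
    using assms by (intro fps_compose_assoc) simp_all
  then show ?thesis
    by (simp add: euler_Em_def fps_X_power_compose power_mult)
qed

text \<open>In Ramanujan's notation \<open>phi m\<close> is \<open>\<phi>(-q\<^sup>m)\<close>, but \<open>psi2 m\<close> is \<open>2\<psi>(q\<^sup>m)\<close>.\<close>

definition phi :: "nat \<Rightarrow> rat fps" where "phi m = theta (- (fps_X ^ m)) (- (fps_X ^ m))"
definition psi2 :: "nat \<Rightarrow> rat fps" where "psi2 m = theta 1 (fps_X ^ m)"
text \<open>\<open>Omega\<close> and \<open>Alpha\<close> are f(-q, -q^5) and f(q, q^2), the new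
  series that occur in the 3-dissections of \<open>phi 1\<close> and \<open>psi2 1\<close>.\<close>

definition Omega :: "rat fps" where "Omega = theta (- fps_X) (- (fps_X ^ 5))"
definition Alpha :: "rat fps" where "Alpha = theta fps_X (fps_X ^ 2)"

lemma phi_euler: "m > 0 \<Longrightarrow> phi m * euler_Em (2 * m) = euler_Em m ^ 2"
  using theta_phi_product[of "fps_X ^ m"]
  by (simp add: phi_def euler_Em_def power_mult[symmetric] mult.commute)

lemma psi2_euler: "m > 0 \<Longrightarrow> psi2 m * euler_Em m = 2 * euler_Em (2 * m) ^ 2"
  using theta_psi_product[of "fps_X ^ m"]
  by (simp add: psi2_def euler_Em_def power_mult[symmetric] mult.commute)

lemma Omega_euler: "Omega * (euler_Em 2 * euler_Em 3) = euler_Em 1 * euler_Em 6 ^ 2"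
  using theta_omega_product[of fps_X] by (simp add: Omega_def euler_Em_def)

lemma Alpha_euler: "Alpha * (euler_Em 1 * euler_Em 6) = euler_Em 2 * euler_Em 3 ^ 2"
  using theta_A_product[of fps_X] by (simp add: Alpha_def euler_Em_def)

lemma phi_nth_0: "m > 0 \<Longrightarrow> phi m $ 0 = 1"
  using arg_cong[OF phi_euler, of m "\<lambda>f. f $ 0"] by (simp add: power2_eq_square)

lemma phi_dissection: "phi 1 = cube_subst (phi 3) - 2 * fps_X * cube_subst Omega"
proof -
  have "cube_subst (phi 3) = theta (- (fps_X ^ 9)) (- (fps_X ^ 9))"
    unfolding phi_def by (subst theta_compose)
      (simp_all add: cube_subst_simps fps_X_power_compose power_mult[symmetric])
  moreover have "cube_subst Omega = theta (- (fps_X ^ 3)) (- (fps_X ^ 15))"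
    unfolding Omega_def by (subst theta_compose)
      (simp_all add: cube_subst_simps fps_X_power_compose power_mult[symmetric])
  moreover have "phi 1 = theta (- (fps_X ^ 9)) (- (fps_X ^ 9)) + - fps_X * theta (- (fps_X ^ 15)) (- (fps_X ^ 3))
       + - fps_X * theta (- (fps_X ^ 3)) (- (fps_X ^ 15))"
    unfolding phi_def
    using theta_dissection[of "- fps_X" "- fps_X"] by (simp add: power_add[symmetric])
  ultimately show ?thesis
    by (simp add: theta_commute[of "- (fps_X ^ 15)"])
qed

lemma psi2_dissection: "psi2 1 = 2 * cube_subst Alpha + fps_X * cube_subst (psi2 3)"
proof -
  have "cube_subst (psi2 3) = theta 1 (fps_X ^ 9)"
    unfolding psi2_def by (subst theta_compose)
      (simp_all add: cube_subst_simps fps_X_power_compose power_mult[symmetric])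
  moreover have "cube_subst Alpha = theta (fps_X ^ 3) (fps_X ^ 6)"
    unfolding Alpha_def by (subst theta_compose)
      (simp_all add: cube_subst_simps fps_X_power_compose power_mult[symmetric])
  moreover have "psi2 1 = theta (fps_X ^ 3) (fps_X ^ 6) + theta (fps_X ^ 6) (fps_X ^ 3)
       + fps_X * theta 1 (fps_X ^ 9)"
    unfolding psi2_def using theta_dissection[of 1 fps_X] by simp
  ultimately show ?thesis
    by (simp add: theta_commute[of "fps_X ^ 6"])
qed

lemma X_fps_euler: "X_fps * (euler_Em 1 ^ 8 * euler_Em 6 ^ 4) = euler_Em 2 ^ 4 * euler_Em 3 ^ 8"
  unfolding X_fps_def by (rule dvd_div_mult_self) (simp add: fps_unit_dvd)

lemma G_fps_euler: "G_fps * euler_Em 1 ^ 4 = euler_Em 2 ^ 5"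
  unfolding G_fps_def by (rule dvd_div_mult_self) (simp add: fps_unit_dvd)

lemma cube_subst_G_fps: "cube_subst G_fps = euler_Em 6 ^ 5 / euler_Em 3 ^ 4"
  unfolding G_fps_def by (subst fps_divide_compose) (simp_all add: cube_subst_simps cube_subst_euler_Em)

text \<open>Relations between Euler quotients are shown here and below after multiplying by a
  product of the nonzero series \<open>euler_Em m\<close>, which is cancelled at the end.\<close>

lemma X_fps_phi: "X_fps * phi 1 ^ 4 = phi 3 ^ 4"
proof -
  have "X_fps * phi 1 ^ 4 * (euler_Em 2 ^ 4 * euler_Em 6 ^ 4) = X_fps * ((phi 1 * euler_Em 2) ^ 4 * euler_Em 6 ^ 4)"
    by algebra
  also have "\<dots> = X_fps * (euler_Em 1 ^ 8 * euler_Em 6 ^ 4)"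
    using phi_euler[of 1] by (simp flip: power_mult)
  also have "\<dots> = euler_Em 2 ^ 4 * (phi 3 * euler_Em 6) ^ 4"
    unfolding X_fps_euler using phi_euler[of 3] by (simp flip: power_mult)
  also have "\<dots> = phi 3 ^ 4 * (euler_Em 2 ^ 4 * euler_Em 6 ^ 4)"
    by algebra
  finally show ?thesis by simp
qed

text \<open>\<open>norm3 (phi 1)\<close> computed twice: the dissection gives the bracket on the
  left, and \<open>phi_euler\<close> with \<open>norm3_euler_Em\<close> gives the quotient of
  \<open>phi 1 ^ 4\<close> by \<open>phi 3\<close>.\<close>

lemma phi_quartic: "(phi 3 ^ 3 - 8 * fps_X * Omega ^ 3) * phi 3 = phi 1 ^ 4"
proof -
  have "norm3 (phi 1) = phi 3 ^ 3 - 8 * fps_X * Omega ^ 3"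
    unfolding phi_dissection using norm3_dissection[of "phi 3" "- 2 * Omega" 0]
    by (simp add: cube_subst_simps fps_compose_mult_distrib fps_compose_uminus
         power_mult_distrib mult_ac)
  moreover have "norm3 (phi 1) * phi 3 * (euler_Em 2 ^ 4 * euler_Em 6) = phi 1 ^ 4 * (euler_Em 2 ^ 4 * euler_Em 6)"
  proof -
    have "norm3 (phi 1) * phi 3 * (euler_Em 2 ^ 4 * euler_Em 6) =
        norm3 (phi 1) * (norm3 (euler_Em 2) * euler_Em 6) * (phi 3 * euler_Em 6)"
      using norm3_euler_Em[of 2] by simp
    also have "\<dots> = norm3 (phi 1 * euler_Em 2) * (euler_Em 3 ^ 2 * euler_Em 6)"
      using phi_euler[of 3] by (simp add: norm3_mult mult_ac)
    also have "phi 1 * euler_Em 2 = euler_Em 1 ^ 2"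
      using phi_euler[of 1] by simp
    also have "norm3 (euler_Em 1 ^ 2) * (euler_Em 3 ^ 2 * euler_Em 6) = (norm3 (euler_Em 1) * euler_Em 3) ^ 2 * euler_Em 6"
      unfolding norm3_power by algebra
    also have "\<dots> = (euler_Em 1 ^ 2) ^ 4 * euler_Em 6"
      using norm3_euler_Em[of 1] by (simp flip: power_mult)
    also have "\<dots> = phi 1 ^ 4 * (euler_Em 2 ^ 4 * euler_Em 6)"
      using phi_euler[of 1] by (simp flip: power_mult_distrib mult.assoc)
    finally show ?thesis .
  qed
  ultimately show ?thesis by simp
qed

text \<open>Says that \<open>Omega\<close> over \<open>phi 3\<close> equals \<open>psi2 3\<close>
  over \<open>2 * Alpha\<close>. This is why one parameter \<open>u_fps\<close> serves both
  dissections.\<close>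

lemma Alpha_Omega: "2 * Alpha * Omega = phi 3 * psi2 3"
proof -
  define c where "c = euler_Em 1 * euler_Em 6 * (euler_Em 2 * euler_Em 3)"
  have "2 * Alpha * Omega * c = 2 * (Alpha * (euler_Em 1 * euler_Em 6)) * (Omega * (euler_Em 2 * euler_Em 3))"
    unfolding c_def by algebra
  also have "\<dots> = euler_Em 1 * euler_Em 2 * euler_Em 3 ^ 2 * (2 * euler_Em 6 ^ 2)"
    unfolding Alpha_euler Omega_euler by algebra
  also have "\<dots> = euler_Em 1 * euler_Em 2 * (phi 3 * euler_Em 6) * (psi2 3 * euler_Em 3)"
    using phi_euler[of 3] psi2_euler[of 3] by simp
  also have "\<dots> = phi 3 * psi2 3 * c"
    unfolding c_def by algebra
  finally show ?thesis by (simp add: c_def)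
qed

lemma G_fps_psi2: "4 * (G_fps * phi 1) = psi2 1 ^ 2"
proof -
  have "4 * (G_fps * phi 1) * (euler_Em 1 ^ 4 * euler_Em 2) = 4 * (G_fps * euler_Em 1 ^ 4) * (phi 1 * euler_Em 2)"
    by algebra
  also have "\<dots> = (2 * euler_Em 2 ^ 2) ^ 2 * euler_Em 1 ^ 2 * euler_Em 2"
  proof -
    have "phi 1 * euler_Em 2 = euler_Em 1 ^ 2" using phi_euler[of 1] by simp
    then show ?thesis unfolding G_fps_euler by algebra
  qed
  also have "2 * euler_Em 2 ^ 2 = psi2 1 * euler_Em 1"
    using psi2_euler[of 1] by simp
  also have "(psi2 1 * euler_Em 1) ^ 2 * euler_Em 1 ^ 2 * euler_Em 2 = psi2 1 ^ 2 * (euler_Em 1 ^ 4 * euler_Em 2)"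
    by algebra
  finally show ?thesis by simp
qed

lemma cube_subst_phi: "cube_subst (phi 1) = phi 3"
  unfolding phi_def by (subst theta_compose) (simp_all add: cube_subst_simps)

lemma cube_subst_psi2: "cube_subst (psi2 1) = psi2 3"
  unfolding psi2_def by (subst theta_compose) simp_all

text \<open>\<open>u_fps\<close> is q w(q^3), and \<open>v_fps\<close> is the series with v(q^3) =
  u^3. Thus u and u^2 lie in the residue classes 1 and 2. \<open>B_fps\<close> collects the factor
  of \<open>G_fps\<close> that is a series in q^3.\<close>

definition w_fps :: "rat fps" where "w_fps = Omega * inverse (phi 3)"
definition u_fps :: "rat fps" where "u_fps = fps_X * cube_subst w_fps"
definition v_fps :: "rat fps" where "v_fps = fps_X * w_fps ^ 3"
definition B_fps :: "rat fps" where "B_fps = Alpha ^ 2 * inverse (phi 3)"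

lemma phi3_nonzero [simp]: "phi 3 \<noteq> 0"
  using phi_nth_0[of 3] by auto

lemma inverse_phi3: "inverse (phi 3) * phi 3 = 1"
  by (rule inverse_mult_eq_1) (simp add: phi_nth_0)

lemma cube_subst_phi3_nonzero [simp]: "cube_subst (phi 3) \<noteq> 0"
proof
  assume "cube_subst (phi 3) = 0"
  from arg_cong[OF this, of "\<lambda>f. f $ 0"] show False by (simp add: phi_nth_0)
qed

lemma Omega_w: "Omega = w_fps * phi 3"
  using inverse_phi3 by (simp add: w_fps_def mult.assoc)

lemma cube_subst_v: "cube_subst v_fps = u_fps ^ 3"
  unfolding v_fps_def u_fps_def cube_subst_simps by algebra

lemma phi1_u: "phi 1 = cube_subst (phi 3) * (1 - 2 * u_fps)"
  unfolding phi_dissection Omega_w u_fps_def cube_subst_simps by algebra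

lemma X_fps_v: "X_fps * (1 - 8 * v_fps) = 1"
proof -
  have "X_fps * (1 - 8 * v_fps) * phi 3 ^ 4 = X_fps * ((phi 3 ^ 3 - 8 * fps_X * Omega ^ 3) * phi 3)"
    unfolding Omega_w v_fps_def by algebra
  also have "\<dots> = 1 * phi 3 ^ 4"
    unfolding phi_quartic X_fps_phi by simp
  finally show ?thesis by simp
qed

lemma T_u: "cube_subst X_fps * (1 - 8 * u_fps ^ 3) = 1"
  using arg_cong[OF X_fps_v, of cube_subst] by (simp add: cube_subst_simps cube_subst_v)

text \<open>Replacing q by q^3 in \<open>X_fps_phi\<close> expresses T through \<open>phi 3\<close>
  and its image under \<open>cube_subst\<close>. In X T the series \<open>phi 3\<close> cancels,
  leaving the fourth power of a ratio that \<open>phi1_u\<close> evaluates.\<close>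

lemma X_T_u: "X_fps * cube_subst X_fps * (1 - 2 * u_fps) ^ 4 = 1"
proof -
  have "cube_subst X_fps * phi 3 ^ 4 = cube_subst (phi 3) ^ 4"
    using arg_cong[OF X_fps_phi, of cube_subst]
    by (simp add: cube_subst_simps cube_subst_phi del: One_nat_def)
  then have "X_fps * cube_subst X_fps * (1 - 2 * u_fps) ^ 4 * phi 3 ^ 4 = X_fps * phi 1 ^ 4"
    unfolding phi1_u by algebra
  also have "\<dots> = 1 * phi 3 ^ 4" by (simp only: X_fps_phi mult_1)
  finally show ?thesis by simp
qed

lemma psi2_3: "psi2 3 = 2 * Alpha * w_fps"
proof -
  have "psi2 3 * phi 3 = 2 * Alpha * w_fps * phi 3"
    using Alpha_Omega unfolding Omega_w by algebra
  then show ?thesis by simp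
qed

lemma psi2_1: "psi2 1 = 2 * cube_subst Alpha * (1 + u_fps)"
  unfolding psi2_dissection psi2_3 u_fps_def cube_subst_simps by algebra

lemma B_fps_phi3: "B_fps * phi 3 = Alpha ^ 2"
  using inverse_phi3 by (simp add: B_fps_def mult.assoc)

lemma G_fps_u: "G_fps * (1 - 2 * u_fps) = cube_subst B_fps * (1 + u_fps) ^ 2"
proof -
  have *: "cube_subst B_fps * cube_subst (phi 3) = cube_subst Alpha ^ 2"
    using arg_cong[OF B_fps_phi3, of cube_subst] by (simp add: cube_subst_simps)
  have "4 * (G_fps * (cube_subst (phi 3) * (1 - 2 * u_fps))) = 4 * (cube_subst Alpha ^ 2 * (1 + u_fps) ^ 2)"
    using G_fps_psi2 unfolding phi1_u[symmetric] psi2_1 by algebra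
  then have "G_fps * (cube_subst (phi 3) * (1 - 2 * u_fps)) = cube_subst Alpha ^ 2 * (1 + u_fps) ^ 2"
    by simp
  then have "G_fps * (1 - 2 * u_fps) * cube_subst (phi 3) = cube_subst B_fps * (1 + u_fps) ^ 2 * cube_subst (phi 3)"
    unfolding *[symmetric] by algebra
  then show ?thesis by simp
qed

text \<open>Residue class 2 of a polynomial in \<open>u_fps\<close> carries precisely the factor
  \<open>w_fps ^ 2\<close>; together with \<open>B_fps\<close> it turns these sections into
  multiples of G(q^3).\<close>

lemma cube_subst_G_fps_B: "cube_subst G_fps = B_fps * w_fps ^ 2"
proof -
  have "4 * (cube_subst G_fps * phi 3) = psi2 3 ^ 2"
    using arg_cong[OF G_fps_psi2, of cube_subst]
    by (simp add: cube_subst_simps cube_subst_phi cube_subst_psi2 del: One_nat_def)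
  then have "4 * (cube_subst G_fps * phi 3) = 4 * (B_fps * w_fps ^ 2 * phi 3)"
    unfolding psi2_3 using B_fps_phi3 by algebra
  then show ?thesis by simp
qed

subsection \<open>The cubic equation and the recurrence\<close>

text \<open>The matrix recurrence in generating form: a step in the row index is a power of X, a
  step in the column index a power of T.\<close>

lemma X_fps_cubic:
  defines "T \<equiv> cube_subst X_fps"
  shows "X_fps ^ 3 = (30 * T - 108 * T ^ 2 + 81 * T ^ 3) * X_fps ^ 2 - (12 * T - 9 * T ^ 2) * X_fps + T"
proof -
  define D C where "D = 1 - 2 * u_fps" and "C = 1 + 2 * u_fps + 4 * u_fps ^ 2"
  have TDC: "T * D * C = 1"
    using T_u unfolding T_def[symmetric] D_def C_def by algebra
  have XTD: "X_fps * T * D ^ 4 = 1"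
    using X_T_u unfolding T_def[symmetric] D_def by simp
  have XD: "X_fps * D ^ 3 = C"
  proof -
    have "X_fps * D ^ 3 = X_fps * D ^ 3 * (T * D * C)" using TDC by simp
    also have "\<dots> = (X_fps * T * D ^ 4) * C" by algebra
    finally show ?thesis using XTD by simp
  qed
  \<comment> \<open>The cubic multiplied by \<open>D ^ 9 * C\<close>, after inserting X = C/D^3 and
    T = 1/(DC); it is an identity of polynomials in \<open>u_fps\<close>.\<close>
  have poly: "C ^ 4 = 30 * (C ^ 2 * D ^ 2) - 108 * (C * D) + 81 - 12 * (D ^ 5 * C) + 9 * D ^ 4 + D ^ 8"
    unfolding C_def D_def by algebra
  have "((30 * T - 108 * T ^ 2 + 81 * T ^ 3) * X_fps ^ 2 - (12 * T - 9 * T ^ 2) * X_fps + T) * (D ^ 9 * C)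
     = 30 * T * D ^ 3 * (X_fps * D ^ 3) ^ 2 * C - 108 * T ^ 2 * D ^ 3 * (X_fps * D ^ 3) ^ 2 * C
       + 81 * T ^ 3 * D ^ 3 * (X_fps * D ^ 3) ^ 2 * C
       - 12 * T * D ^ 6 * (X_fps * D ^ 3) * C + 9 * T ^ 2 * D ^ 6 * (X_fps * D ^ 3) * C + T * D ^ 9 * C"
    by algebra
  also have "\<dots> = 30 * (T * D * C) * C ^ 2 * D ^ 2 - 108 * (T * D * C) ^ 2 * C * D + 81 * (T * D * C) ^ 3
       - 12 * (T * D * C) * C * D ^ 5 + 9 * (T * D * C) ^ 2 * D ^ 4 + (T * D * C) * D ^ 8"
    unfolding XD by algebra
  also have "\<dots> = C ^ 4" unfolding TDC poly by (simp add: mult_ac)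
  also have "\<dots> = (X_fps * D ^ 3) ^ 3 * C" unfolding XD by algebra
  also have "\<dots> = X_fps ^ 3 * (D ^ 9 * C)" by algebra
  finally have "((30 * T - 108 * T ^ 2 + 81 * T ^ 3) * X_fps ^ 2 - (12 * T - 9 * T ^ 2) * X_fps + T) * (D ^ 9 * C)
     = X_fps ^ 3 * (D ^ 9 * C)" .
  moreover have "D ^ 9 * C \<noteq> 0"
    using TDC by auto
  ultimately show ?thesis by simp
qed

lemma section3_diff: "section3 r (f - h) = section3 r f - section3 r h"
  by (simp add: fps_eq_iff section3_def)

text \<open>The coefficients of the cubic are polynomials in X(q^3); taking a section pulls them out
  with q^3 replaced by q.\<close>

lemma section3_X_power_rec:
  assumes "r < 3"
  shows "section3 r (F * X_fps ^ (i + 3)) =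
    (30 * X_fps - 108 * X_fps ^ 2 + 81 * X_fps ^ 3) * section3 r (F * X_fps ^ (i + 2))
    - (12 * X_fps - 9 * X_fps ^ 2) * section3 r (F * X_fps ^ (i + 1)) + X_fps * section3 r (F * X_fps ^ i)"
proof -
  have "F * X_fps ^ (i + 3) = F * X_fps ^ i * X_fps ^ 3"
    by (simp add: power_add)
  also have "\<dots> = cube_subst (30 * X_fps - 108 * X_fps ^ 2 + 81 * X_fps ^ 3) * (F * X_fps ^ (i + 2))
     - cube_subst (12 * X_fps - 9 * X_fps ^ 2) * (F * X_fps ^ (i + 1)) + cube_subst X_fps * (F * X_fps ^ i)"
  proof -
    obtain y where y: "X_fps ^ i = y" by simp
    have y1: "X_fps ^ (i + 1) = y * X_fps" and y2: "X_fps ^ (i + 2) = y * X_fps ^ 2"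
      unfolding power_add y by simp_all
    show ?thesis
      using X_fps_cubic unfolding cube_subst_simps y y1 y2 by algebra
  qed
  finally show ?thesis
    using assms by (simp only: section3_add section3_diff section3_cube_subst_mult)
qed

lemmas u_dissection_simps = cube_subst_simps u_fps_def v_fps_def fps_compose_1

text \<open>This is \<open>X_fps\<close> to the power \<open>-2\<close>. Starting the recurrence there keeps the polynomials in
  \<open>u_fps\<close> that have to be dissected small.\<close>

definition H_fps :: "rat fps" where
  "H_fps = cube_subst X_fps ^ 2 * (1 - 2 * u_fps) ^ 8"

lemma H_fps_X: "H_fps * X_fps = cube_subst X_fps * (1 - 2 * u_fps) ^ 4"
  using X_T_u unfolding H_fps_def by algebra

lemma H_fps_X2: "H_fps * X_fps ^ 2 = 1"
  using X_T_u unfolding H_fps_def by algebra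

lemma H_fps_X_power: "H_fps * X_fps ^ (i + 2) = X_fps ^ i"
  using H_fps_X2 unfolding power_add by (metis mult.left_commute mult_1_right)

text \<open>Sort the powers of \<open>u_fps\<close> by exponent modulo 3, keep the wanted class, and
  eliminate \<open>v_fps\<close> by 8v = 1 - 1/X. The other starting sections follow the same
  pattern.\<close>

lemma section3_0_H: "section3 0 H_fps = 28 - 27 * X_fps ^ 2"
proof -
  have "(1 - 2 * u_fps) ^ 8 = cube_subst (1 - 448 * v_fps + 1792 * v_fps ^ 2) +
     fps_X * cube_subst (w_fps * (1120 * v_fps - 16 - 1024 * v_fps ^ 2)) +
     fps_X ^ 2 * cube_subst (w_fps ^ 2 * (112 - 1792 * v_fps + 256 * v_fps ^ 2))"
    unfolding u_dissection_simps by algebra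
  then have "section3 0 H_fps = X_fps ^ 2 * (1 - 448 * v_fps + 1792 * v_fps ^ 2)"
    unfolding H_fps_def cube_subst_simps(5)[symmetric]
    by (simp only: section3_cube_subst_mult[of 0, simplified] section3_dissection)
  then show ?thesis using X_fps_v by algebra
qed

lemma section3_0_HX: "section3 0 (H_fps * X_fps) = 4 - 3 * X_fps"
proof -
  have "(1 - 2 * u_fps) ^ 4 = cube_subst (1 - 32 * v_fps) +
     fps_X * cube_subst (w_fps * (16 * v_fps - 8)) + fps_X ^ 2 * cube_subst (w_fps ^ 2 * 24)"
    unfolding u_dissection_simps by algebra
  then have "section3 0 (H_fps * X_fps) = X_fps * (1 - 32 * v_fps)"
    unfolding H_fps_X
    by (simp only: section3_cube_subst_mult[of 0, simplified] section3_dissection)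
  then show ?thesis using X_fps_v by algebra
qed

lemma section3_0_HX2: "section3 0 (H_fps * X_fps ^ 2) = 1"
  unfolding H_fps_X2 using section3_cube_subst(1)[of 1] by simp

lemma section3_2_GH:
  "section3 2 (G_fps * H_fps) = cube_subst G_fps * (81 * X_fps ^ 2 - 27 * X_fps + 3)"
proof -
  have "(1 + u_fps) ^ 2 * (1 - 2 * u_fps) ^ 7 =
     cube_subst (1 - 126 * v_fps - 336 * v_fps ^ 2 - 128 * v_fps ^ 3) +
     fps_X * cube_subst (w_fps * (84 * v_fps - 12 + 96 * v_fps ^ 2)) +
     fps_X ^ 2 * cube_subst (w_fps ^ 2 * (57 + 168 * v_fps + 192 * v_fps ^ 2))"
    unfolding u_dissection_simps by algebra
  \<comment> \<open>One of the eight factors \<open>1 - 2 * u_fps\<close> of \<open>H_fps\<close>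
    cancels the denominator of \<open>G_fps\<close>.\<close>
  moreover have "G_fps * H_fps = cube_subst (B_fps * X_fps ^ 2) * ((1 + u_fps) ^ 2 * (1 - 2 * u_fps) ^ 7)"
    using G_fps_u unfolding H_fps_def cube_subst_simps by algebra
  ultimately have "section3 2 (G_fps * H_fps) =
     B_fps * X_fps ^ 2 * (w_fps ^ 2 * (57 + 168 * v_fps + 192 * v_fps ^ 2))"
    by (simp only: section3_cube_subst_mult[of 2, simplified] section3_dissection)
  also have "\<dots> = cube_subst G_fps * (X_fps ^ 2 * (57 + 168 * v_fps + 192 * v_fps ^ 2))"
    unfolding cube_subst_G_fps_B by algebra
  also have "X_fps ^ 2 * (57 + 168 * v_fps + 192 * v_fps ^ 2) = 81 * X_fps ^ 2 - 27 * X_fps + 3"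
    using X_fps_v by algebra
  finally show ?thesis .
qed

lemma section3_2_GHX: "section3 2 (G_fps * H_fps * X_fps) = cube_subst G_fps"
proof -
  have "(1 + u_fps) ^ 2 * (1 - 2 * u_fps) ^ 3 =
     cube_subst (1 + 10 * v_fps) + fps_X * cube_subst (w_fps * (- 4 - 4 * v_fps)) +
     fps_X ^ 2 * cube_subst (w_fps ^ 2 * (1 - 8 * v_fps))"
    unfolding u_dissection_simps by algebra
  moreover have "G_fps * H_fps * X_fps = cube_subst (B_fps * X_fps) * ((1 + u_fps) ^ 2 * (1 - 2 * u_fps) ^ 3)"
    using G_fps_u H_fps_X unfolding cube_subst_simps by algebra
  ultimately have "section3 2 (G_fps * H_fps * X_fps) = B_fps * X_fps * (w_fps ^ 2 * (1 - 8 * v_fps))"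
    by (simp only: section3_cube_subst_mult[of 2, simplified] section3_dissection)
  also have "\<dots> = cube_subst G_fps * (X_fps * (1 - 8 * v_fps))"
    unfolding cube_subst_G_fps_B by algebra
  finally show ?thesis unfolding X_fps_v by simp
qed

lemma section3_2_G: "section3 2 G_fps = cube_subst G_fps * (9 * X_fps)"
proof -
  \<comment> \<open>Without \<open>H_fps\<close> the denominator of \<open>G_fps\<close> is cleared
    by 1/(1 - 2u) = T (1 + 2u + 4u^2).\<close>
  have "(1 + u_fps) ^ 2 * (1 + 2 * u_fps + 4 * u_fps ^ 2) =
     cube_subst (1 + 10 * v_fps) + fps_X * cube_subst (w_fps * (4 + 4 * v_fps)) +
     fps_X ^ 2 * cube_subst (w_fps ^ 2 * 9)"
    unfolding u_dissection_simps by algebra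
  moreover have "G_fps = cube_subst (B_fps * X_fps) * ((1 + u_fps) ^ 2 * (1 + 2 * u_fps + 4 * u_fps ^ 2))"
    using G_fps_u T_u unfolding cube_subst_simps by algebra
  ultimately have "section3 2 G_fps = B_fps * X_fps * (w_fps ^ 2 * 9)"
    by (metis section3_cube_subst_mult[of 2, simplified] section3_dissection(3))
  then show ?thesis unfolding cube_subst_G_fps_B by algebra
qed

section \<open>Matrix rows as polynomials in X\<close>

definition X_poly :: "nat \<Rightarrow> (nat \<Rightarrow> int) \<Rightarrow> rat fps" where
  "X_poly M f = (\<Sum>j\<le>M. of_int (f j) * X_fps ^ j)"

lemma X_poly_extend:
  assumes "M \<le> N" "\<And>j. j > M \<Longrightarrow> f j = 0"
  shows "X_poly N f = X_poly M f"
  unfolding X_poly_def using assms by (intro sum.mono_neutral_right) auto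

text \<open>For \<open>j < k\<close> the difference \<open>j - k\<close> truncates to 0, where
  \<open>f\<close> vanishes, so the low terms drop out.\<close>

lemma X_poly_shift:
  assumes "f 0 = 0" "\<And>j. j > M \<Longrightarrow> f j = 0"
  shows "X_poly (M + k) (\<lambda>j. f (j - k)) = X_fps ^ k * X_poly M f"
proof -
  have "X_poly (M + k) (\<lambda>j. f (j - k)) = (\<Sum>j\<in>{k..M + k}. of_int (f (j - k)) * X_fps ^ j)"
    unfolding X_poly_def using assms(1) by (intro sum.mono_neutral_right) auto
  also have "\<dots> = (\<Sum>j\<le>M. of_int (f j) * X_fps ^ (j + k))"
    by (rule sum.reindex_bij_witness[of _ "\<lambda>j. j + k" "\<lambda>j. j - k"]) auto
  finally show ?thesis
    by (simp add: X_poly_def sum_distrib_left power_add mult_ac)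
qed

declare rec_mat.simps [simp del]

lemma rec_mat_0 [simp]: "rec_mat r i 0 = 0"
  by (simp add: rec_mat.simps)

lemma rec_mat_init: "i \<le> 3 \<Longrightarrow> j > 0 \<Longrightarrow> rec_mat r i j = r i j"
  by (simp add: rec_mat.simps)

lemma rec_mat_rec:
  assumes "i > 0"
  shows "rec_mat r (i + 3) j = 30 * rec_mat r (i + 2) (j - 1) - 108 * rec_mat r (i + 2) (j - 2)
     + 81 * rec_mat r (i + 2) (j - 3) - 12 * rec_mat r (i + 1) (j - 1)
     + 9 * rec_mat r (i + 1) (j - 2) + rec_mat r i (j - 1)"
  using assms by (subst rec_mat.simps) auto

text \<open>The bound fits the initial rows of b, of lengths 4, 7, 10, and covers those of a, of
  lengths 3, 6, 9. It persists because the recurrence moves the column by at most 3 per row.\<close>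

lemma rec_mat_eq_0:
  assumes init: "\<forall>i\<in>{1..3}. \<forall>j>3 * i + 1. r i j = 0"
    and "i \<ge> 1" "j > 3 * i + 1"
  shows "rec_mat r i j = 0"
  using assms(2,3)
proof (induction i arbitrary: j rule: less_induct)
  case (less i)
  show ?case
  proof (cases "i \<le> 3")
    case True
    then show ?thesis using less.prems init by (simp add: rec_mat_init)
  next
    case False
    define k where "k = i - 3"
    have k: "k > 0" "i = k + 3" using False by (auto simp: k_def)
    show ?thesis
      unfolding k(2) rec_mat_rec[OF k(1)] using k less.prems by (simp add: less.IH)
  qed
qed

lemma X_poly_rec_mat:
  assumes init: "\<forall>i\<in>{1..3}. \<forall>j>3 * i + 1. r i j = 0"
    and i: "i > 0"
  defines "R \<equiv> \<lambda>i. X_poly (3 * i + 1) (rec_mat r i)"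
  shows "R (i + 3) = (30 * X_fps - 108 * X_fps ^ 2 + 81 * X_fps ^ 3) * R (i + 2)
    - (12 * X_fps - 9 * X_fps ^ 2) * R (i + 1) + X_fps * R i"
proof -
  define M where "M = 3 * (i + 3) + 1"
  have shift: "X_poly M (\<lambda>j. rec_mat r l (j - k)) = X_fps ^ k * R l"
    if "l \<ge> 1" "3 * l + 1 + k \<le> M" for l k
  proof -
    have z: "rec_mat r l j = 0" if "j > 3 * l + 1" for j
      using rec_mat_eq_0[OF init] \<open>l \<ge> 1\<close> that by blast
    have "X_poly M (\<lambda>j. rec_mat r l (j - k)) = X_poly (3 * l + 1 + k) (\<lambda>j. rec_mat r l (j - k))"
      by (rule X_poly_extend) (use that z in auto)
    also have "\<dots> = X_fps ^ k * R l"
      unfolding R_def by (rule X_poly_shift) (use z in auto)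
    finally show ?thesis .
  qed
  have "R (i + 3) = 30 * X_poly M (\<lambda>j. rec_mat r (i + 2) (j - 1)) - 108 * X_poly M (\<lambda>j. rec_mat r (i + 2) (j - 2))
     + 81 * X_poly M (\<lambda>j. rec_mat r (i + 2) (j - 3)) - 12 * X_poly M (\<lambda>j. rec_mat r (i + 1) (j - 1))
     + 9 * X_poly M (\<lambda>j. rec_mat r (i + 1) (j - 2)) + X_poly M (\<lambda>j. rec_mat r i (j - 1))"
    unfolding R_def M_def[symmetric] X_poly_def rec_mat_rec[OF i]
    by (simp add: sum_distrib_left algebra_simps flip: sum.distrib sum_subtractf)
  also have "\<dots> = 30 * (X_fps ^ 1 * R (i + 2)) - 108 * (X_fps ^ 2 * R (i + 2)) + 81 * (X_fps ^ 3 * R (i + 2))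
     - 12 * (X_fps ^ 1 * R (i + 1)) + 9 * (X_fps ^ 2 * R (i + 1)) + X_fps ^ 1 * R i"
    using i by (subst (1 2 3 4 5 6) shift) (simp_all add: M_def)
  finally show ?thesis by algebra
qed

text \<open>Both sides satisfy the same third-order recurrence, so agreement for the first three
  rows is enough. The factor \<open>c\<close> is 1 for the matrix a and G(q^3) for b.\<close>

lemma section3_rec_mat:
  assumes r: "r < 3"
    and init: "\<forall>i\<in>{1..3}. \<forall>j>3 * i + 1. m i j = 0"
    and base: "\<forall>i\<in>{1..3}. section3 r (F * X_fps ^ i) = c * X_poly (3 * i + 1) (rec_mat m i)"
    and "i \<ge> 1"
  shows "section3 r (F * X_fps ^ i) = c * X_poly (3 * i + 1) (rec_mat m i)"
  using \<open>i \<ge> 1\<close>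
proof (induction i rule: less_induct)
  case (less i)
  show ?case
  proof (cases "i \<le> 3")
    case True
    then show ?thesis using less.prems base by simp
  next
    case False
    define k where "k = i - 3"
    have k: "k > 0" "i = k + 3" using False by (auto simp: k_def)
    have rec: "X_poly (3 * (k + 3) + 1) (rec_mat m (k + 3)) =
        (30 * X_fps - 108 * X_fps ^ 2 + 81 * X_fps ^ 3) * X_poly (3 * (k + 2) + 1) (rec_mat m (k + 2))
        - (12 * X_fps - 9 * X_fps ^ 2) * X_poly (3 * (k + 1) + 1) (rec_mat m (k + 1))
        + X_fps * X_poly (3 * k + 1) (rec_mat m k)"
      by (rule X_poly_rec_mat[OF init k(1)])
    have IH: "section3 r (F * X_fps ^ l) = c * X_poly (3 * l + 1) (rec_mat m l)"
      if "l = k + 2 \<or> l = k + 1 \<or> l = k" for l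
      using that k by (intro less.IH) auto
    show ?thesis
      unfolding k(2) section3_X_power_rec[OF r] rec
      by (simp only: IH simp_thms) algebra
  qed
qed

lemma X_poly_numeral: "X_poly (numeral n) f = X_poly (pred_numeral n) f + of_int (f (numeral n)) * X_fps ^ numeral n"
  and X_poly_0: "X_poly 0 f = of_int (f 0)"
  and X_poly_Suc: "X_poly (Suc M) f = X_poly M f + of_int (f (Suc M)) * X_fps ^ Suc M"
  by (simp_all add: X_poly_def numeral_eq_Suc)

lemma a_init_eq_0: "\<forall>i\<in>{1..3}. \<forall>j>3 * i + 1. a_init i j = 0"
  by (auto simp: a_init_def row_entry_def)

lemma b_init_eq_0: "\<forall>i\<in>{1..3}. \<forall>j>3 * i + 1. b_init i j = 0"
  by (auto simp: b_init_def row_entry_def)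

lemma a_rows:
  "X_poly 4 (rec_mat a_init 1) = 10 * X_fps - 36 * X_fps ^ 2 + 27 * X_fps ^ 3"
  "X_poly 7 (rec_mat a_init 2) = - 8 * X_fps + 306 * X_fps ^ 2 - 2160 * X_fps ^ 3 + 5508 * X_fps ^ 4
     - 5832 * X_fps ^ 5 + 2187 * X_fps ^ 6"
  "X_poly 10 (rec_mat a_init 3) = X_fps - 360 * X_fps ^ 2 + 10566 * X_fps ^ 3 - 99144 * X_fps ^ 4
     + 423549 * X_fps ^ 5 - 944784 * X_fps ^ 6 + 1141614 * X_fps ^ 7 - 708588 * X_fps ^ 8 + 177147 * X_fps ^ 9"
  by (simp_all add: X_poly_numeral X_poly_0 X_poly_Suc rec_mat_init a_init_def row_entry_def)

lemma b_rows:
  "X_poly 4 (rec_mat b_init 1) = - 9 * X_fps + 252 * X_fps ^ 2 - 891 * X_fps ^ 3 + 729 * X_fps ^ 4"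
  "X_poly 7 (rec_mat b_init 2) = X_fps - 378 * X_fps ^ 2 + 8613 * X_fps ^ 3 - 54675 * X_fps ^ 4
     + 138510 * X_fps ^ 5 - 150903 * X_fps ^ 6 + 59049 * X_fps ^ 7"
  "X_poly 10 (rec_mat b_init 3) = 147 * X_fps ^ 2 - 14553 * X_fps ^ 3 + 312255 * X_fps ^ 4
     - 2617839 * X_fps ^ 5 + 10764414 * X_fps ^ 6 - 23914845 * X_fps ^ 7 + 29288304 * X_fps ^ 8
     - 18600435 * X_fps ^ 9 + 4782969 * X_fps ^ 10"
  by (simp_all add: X_poly_numeral X_poly_0 X_poly_Suc rec_mat_init b_init_def row_entry_def)

subsection \<open>The two sequences of identities\<close>

lemma section3_0_X_power:
  assumes "i \<ge> 1"
  shows "section3 0 (X_fps ^ i) = X_poly (3 * i + 1) (a_mat i)"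
proof -
  \<comment> \<open>The index is shifted by two: \<open>s 0\<close>, \<open>s 1\<close>,
    \<open>s 2\<close> belong to the powers -2, -1, 0 of X, and three steps of the recurrence
    produce the prescribed rows 1 to 3.\<close>
  define s where "s = (\<lambda>n. section3 0 (H_fps * X_fps ^ n))"
  have s_eq: "section3 0 (X_fps ^ n) = s (n + 2)" for n
    unfolding s_def H_fps_X_power ..
  have s: "s 0 = 28 - 27 * X_fps ^ 2" "s 1 = 4 - 3 * X_fps" "s 2 = 1"
    using section3_0_H section3_0_HX section3_0_HX2 by (simp_all add: s_def)
  have rec: "s (n + 3) = (30 * X_fps - 108 * X_fps ^ 2 + 81 * X_fps ^ 3) * s (n + 2)
    - (12 * X_fps - 9 * X_fps ^ 2) * s (n + 1) + X_fps * s n" for n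
    unfolding s_def by (rule section3_X_power_rec) simp
  have s3: "s 3 = 10 * X_fps - 36 * X_fps ^ 2 + 27 * X_fps ^ 3"
    using rec[of 0] unfolding add_0 s by algebra
  have s4: "s 4 = - 8 * X_fps + 306 * X_fps ^ 2 - 2160 * X_fps ^ 3 + 5508 * X_fps ^ 4
     - 5832 * X_fps ^ 5 + 2187 * X_fps ^ 6"
  proof -
    have "s 4 = (30 * X_fps - 108 * X_fps ^ 2 + 81 * X_fps ^ 3) * s 3
      - (12 * X_fps - 9 * X_fps ^ 2) * s 2 + X_fps * s 1" using rec[of 1] by (simp del: One_nat_def)
    then show ?thesis unfolding s s3 by algebra
  qed
  have s5: "s 5 = X_fps - 360 * X_fps ^ 2 + 10566 * X_fps ^ 3 - 99144 * X_fps ^ 4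
     + 423549 * X_fps ^ 5 - 944784 * X_fps ^ 6 + 1141614 * X_fps ^ 7 - 708588 * X_fps ^ 8 + 177147 * X_fps ^ 9"
  proof -
    have "s 5 = (30 * X_fps - 108 * X_fps ^ 2 + 81 * X_fps ^ 3) * s 4
      - (12 * X_fps - 9 * X_fps ^ 2) * s 3 + X_fps * s 2" using rec[of 2] by simp
    then show ?thesis unfolding s s3 s4 by algebra
  qed
  have "section3 0 (1 * X_fps ^ n) = 1 * X_poly (3 * n + 1) (rec_mat a_init n)"
    if "n \<in> {1..3}" for n
  proof -
    have "n = 1 \<or> n = 2 \<or> n = 3" using that by auto
    then show ?thesis
      using a_rows s3 s4 s5 unfolding mult_1 s_eq by (elim disjE) (simp_all del: One_nat_def)
  qed
  then have "\<forall>n\<in>{1..3}. section3 0 (1 * X_fps ^ n) = 1 * X_poly (3 * n + 1) (rec_mat a_init n)" by blast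
  from section3_rec_mat[OF _ a_init_eq_0 this assms] show ?thesis
    by (simp add: a_mat_def)
qed

lemma section3_2_G_X_power:
  assumes "i \<ge> 1"
  shows "section3 2 (G_fps * X_fps ^ i) = cube_subst G_fps * X_poly (3 * i + 1) (b_mat i)"
proof -
  define K where "K = cube_subst G_fps"
  \<comment> \<open>The same shift, with \<open>G_fps\<close> as an extra factor: \<open>s 2\<close>
    is the section of \<open>G_fps\<close> itself.\<close>
  define s where "s = (\<lambda>n. section3 2 (G_fps * H_fps * X_fps ^ n))"
  have s_eq: "section3 2 (G_fps * X_fps ^ n) = s (n + 2)" for n
    unfolding s_def by (simp only: H_fps_X_power mult.assoc)
  have s: "s 0 = K * (81 * X_fps ^ 2 - 27 * X_fps + 3)" "s 1 = K" "s 2 = K * (9 * X_fps)"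
    using section3_2_GH section3_2_GHX section3_2_G H_fps_X2
    by (simp_all add: s_def K_def mult.assoc)
  have rec: "s (n + 3) = (30 * X_fps - 108 * X_fps ^ 2 + 81 * X_fps ^ 3) * s (n + 2)
    - (12 * X_fps - 9 * X_fps ^ 2) * s (n + 1) + X_fps * s n" for n
    unfolding s_def by (rule section3_X_power_rec) simp
  have s3: "s 3 = K * (- 9 * X_fps + 252 * X_fps ^ 2 - 891 * X_fps ^ 3 + 729 * X_fps ^ 4)"
    using rec[of 0] unfolding add_0 s by algebra
  have s4: "s 4 = K * (X_fps - 378 * X_fps ^ 2 + 8613 * X_fps ^ 3 - 54675 * X_fps ^ 4
     + 138510 * X_fps ^ 5 - 150903 * X_fps ^ 6 + 59049 * X_fps ^ 7)"
  proof -
    have "s 4 = (30 * X_fps - 108 * X_fps ^ 2 + 81 * X_fps ^ 3) * s 3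
      - (12 * X_fps - 9 * X_fps ^ 2) * s 2 + X_fps * s 1" using rec[of 1] by (simp del: One_nat_def)
    then show ?thesis unfolding s s3 by algebra
  qed
  have s5: "s 5 = K * (147 * X_fps ^ 2 - 14553 * X_fps ^ 3 + 312255 * X_fps ^ 4
     - 2617839 * X_fps ^ 5 + 10764414 * X_fps ^ 6 - 23914845 * X_fps ^ 7 + 29288304 * X_fps ^ 8
     - 18600435 * X_fps ^ 9 + 4782969 * X_fps ^ 10)"
  proof -
    have "s 5 = (30 * X_fps - 108 * X_fps ^ 2 + 81 * X_fps ^ 3) * s 4
      - (12 * X_fps - 9 * X_fps ^ 2) * s 3 + X_fps * s 2" using rec[of 2] by simp
    then show ?thesis unfolding s s3 s4 by algebra
  qed
  have "section3 2 (G_fps * X_fps ^ n) = K * X_poly (3 * n + 1) (rec_mat b_init n)"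
    if "n \<in> {1..3}" for n
  proof -
    have "n = 1 \<or> n = 2 \<or> n = 3" using that by auto
    then show ?thesis
      using b_rows s3 s4 s5 unfolding s_eq by (elim disjE) (simp_all del: One_nat_def)
  qed
  then have "\<forall>n\<in>{1..3}. section3 2 (G_fps * X_fps ^ n) = K * X_poly (3 * n + 1) (rec_mat b_init n)" by blast
  from section3_rec_mat[OF _ b_init_eq_0 this assms] show ?thesis
    by (simp add: b_mat_def K_def)
qed

section \<open>From single powers of X to the coefficient vectors d\<close>

lemma X_series_eq_X_poly:
  assumes "v 0 = 0" "\<forall>j>M. v j = 0"
  shows "X_series v = X_poly M v"
  unfolding X_series_def X_poly_def fps_of_int using assms
  by (intro sum.mono_neutral_left) (auto simp: not_less[symmetric] Suc_le_eq intro!: gr0I)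

lemma mat_step_eq:
  assumes "\<forall>j>M. v j = 0"
  shows "mat_step m v j = (\<Sum>k\<in>{1..M}. m k j * v k)"
  unfolding mat_step_def using assms
  by (intro sum.mono_neutral_left) (auto simp: not_less[symmetric])

lemma mat_step_eq_0:
  assumes "\<forall>j>M. v j = 0" "\<forall>k\<ge>1. \<forall>j>3 * k + 1. m k j = 0"
    and "j > 3 * M + 1"
  shows "mat_step m v j = 0"
  unfolding mat_step_eq[OF assms(1)] using assms(2,3) by (intro sum.neutral) auto

text \<open>Linearity of the section and an exchange of two finite sums give the matrix-vector
  product. All rows \<open>k \<le> M\<close> fit the common bound \<open>3 * M + 1\<close>.\<close>

lemma section3_X_series:
  assumes r: "r < 3"
    and F: "\<forall>k\<ge>1. section3 r (F * X_fps ^ k) = c * X_poly (3 * k + 1) (m k)"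
    and m0: "\<And>k. m k 0 = 0" and m: "\<forall>k\<ge>1. \<forall>j>3 * k + 1. m k j = 0"
    and v0: "v 0 = 0" and v: "\<forall>j>M. v j = 0"
  shows "section3 r (F * X_series v) = c * X_series (mat_step m v)"
proof -
  have sec_const: "section3 r (of_int z * f) = of_int z * section3 r f" for z f
    by (simp add: section3_def fps_eq_iff flip: fps_of_int)
  have sec_sum: "section3 r (\<Sum>k\<in>A. f k) = (\<Sum>k\<in>A. section3 r (f k))" for f :: "nat \<Rightarrow> rat fps" and A
    by (simp add: section3_def fps_eq_iff fps_sum_nth)
  have "X_series v = (\<Sum>k\<in>{1..M}. of_int (v k) * X_fps ^ k)"
    unfolding X_series_eq_X_poly[where M = M, OF v0 v] X_poly_def using v0
    by (intro sum.mono_neutral_right) (auto simp: Suc_le_eq)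
  then have "section3 r (F * X_series v) = (\<Sum>k\<in>{1..M}. section3 r (of_int (v k) * (F * X_fps ^ k)))"
    by (simp add: sum_distrib_left mult.left_commute flip: sec_sum)
  also have "\<dots> = (\<Sum>k\<in>{1..M}. of_int (v k) * (c * X_poly (3 * M + 1) (m k)))"
  proof (intro sum.cong refl)
    fix k assume k: "k \<in> {1..M}"
    have "X_poly (3 * M + 1) (m k) = X_poly (3 * k + 1) (m k)"
      using k m by (intro X_poly_extend) auto
    then show "section3 r (of_int (v k) * (F * X_fps ^ k)) = of_int (v k) * (c * X_poly (3 * M + 1) (m k))"
      using k F by (simp add: sec_const)
  qed
  also have "\<dots> = c * X_poly (3 * M + 1) (mat_step m v)"
    unfolding X_poly_def mat_step_eq[where M = M, OF v] of_int_sum sum_distrib_right sum_distrib_left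
    by (subst sum.swap) (simp add: mult_ac)
  also have "X_poly (3 * M + 1) (mat_step m v) = X_series (mat_step m v)"
    using mat_step_eq_0[where M = M, OF v m]
    by (intro X_series_eq_X_poly[symmetric]) (auto simp: mat_step_def m0)
  finally show ?thesis .
qed

lemma a_mat_0: "a_mat k 0 = 0" and b_mat_0: "b_mat k 0 = 0"
  by (simp_all add: a_mat_def b_mat_def)

lemma a_mat_eq_0: "\<forall>k\<ge>1. \<forall>j>3 * k + 1. a_mat k j = 0"
  unfolding a_mat_def using rec_mat_eq_0[OF a_init_eq_0] by blast

lemma b_mat_eq_0: "\<forall>k\<ge>1. \<forall>j>3 * k + 1. b_mat k j = 0"
  unfolding b_mat_def using rec_mat_eq_0[OF b_init_eq_0] by blast

lemma d_0: "d n 0 = 0"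
  by (cases n rule: d.cases) (auto simp: mat_step_def a_mat_0 b_mat_0)

lemma d_finite_support: "\<exists>M. \<forall>j>M. d n j = 0"
proof (induction n rule: d.induct)
  case (3 n)
  then obtain M where M: "\<forall>j>M. d (Suc n) j = 0" by blast
  then have "\<forall>j>3 * M + 1. d (Suc (Suc n)) j = 0"
    using mat_step_eq_0[OF M a_mat_eq_0] mat_step_eq_0[OF M b_mat_eq_0] by simp
  then show ?case by blast
qed auto

lemma section3_0_X_series:
  "section3 0 (X_series (d (Suc (2 * k)))) = X_series (d (Suc (Suc (2 * k))))"
proof -
  obtain M where M: "\<forall>j>M. d (Suc (2 * k)) j = 0" using d_finite_support by blast
  have "section3 0 (1 * X_series (d (Suc (2 * k)))) = 1 * X_series (mat_step a_mat (d (Suc (2 * k))))"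
    by (rule section3_X_series[where M = M])
      (use section3_0_X_power a_mat_eq_0 M in \<open>simp_all add: a_mat_0 d_0 del: d.simps\<close>)
  then show ?thesis by simp
qed

lemma section3_2_G_X_series:
  "section3 2 (G_fps * X_series (d (Suc (Suc (2 * k))))) = cube_subst G_fps * X_series (d (Suc (Suc (Suc (2 * k)))))"
proof -
  obtain M where M: "\<forall>j>M. d (Suc (Suc (2 * k))) j = 0" using d_finite_support by blast
  have "section3 2 (G_fps * X_series (d (Suc (Suc (2 * k))))) =
      cube_subst G_fps * X_series (mat_step b_mat (d (Suc (Suc (2 * k)))))"
    by (rule section3_X_series[where M = M])
      (use section3_2_G_X_power b_mat_eq_0 M in \<open>simp_all add: b_mat_0 d_0 del: d.simps\<close>)
  then show ?thesis by simp
qed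

text \<open>The increment \<open>2 * 9 ^ k\<close> of the offset is what makes an odd step select
  residue 2 modulo 3; an even step keeps the offset and selects residue 0.\<close>

lemma nine_power_minus_1_div_4: "((9::nat) ^ Suc k - 1) div 4 = 2 * 9 ^ k + (9 ^ k - 1) div 4"
proof -
  have "(9::nat) ^ k mod 4 = 1"
  proof (induction k)
    case (Suc k)
    then show ?case unfolding power_Suc by presburger
  qed simp
  then show ?thesis by simp
qed

theorem theorem2p6:
  fixes \<alpha> :: nat
  assumes "1 \<le> \<alpha>"
  shows "(Abs_fps (\<lambda>n. g (3^(2*\<alpha>-1) * n + (3^(2*\<alpha>) - 1) div 4))
           = (euler_Em 6 ^ 5 / euler_Em 3 ^ 4) * X_series (d (2*\<alpha>-1))) \<and>
         (Abs_fps (\<lambda>n. g (3^(2*\<alpha>) * n + (3^(2*\<alpha>) - 1) div 4))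
           = (euler_Em 2 ^ 5 / euler_Em 1 ^ 4) * X_series (d (2*\<alpha>)))"
proof -
  define odd_ser where "odd_ser = (\<lambda>k. Abs_fps (\<lambda>n. g (3 * 9 ^ k * n + (9 ^ Suc k - 1) div 4)))"
  define even_ser where "even_ser = (\<lambda>k. Abs_fps (\<lambda>n. g (9 ^ k * n + (9 ^ k - 1) div 4)))"
  have odd_step: "odd_ser k = section3 2 (even_ser k)" for k
    unfolding odd_ser_def even_ser_def nine_power_minus_1_div_4
    by (simp add: section3_def fps_eq_iff algebra_simps)
  have even_step: "even_ser (Suc k) = section3 0 (odd_ser k)" for k
    unfolding odd_ser_def even_ser_def
    by (simp add: section3_def fps_eq_iff algebra_simps)
  \<comment> \<open>The induction alternates two moves: residue 2 applied to G times a polynomial in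
    X applies b and yields G(q^3), while residue 0 applies a and turns G(q^3) back into G.\<close>
  have *: "odd_ser k = cube_subst G_fps * X_series (d (Suc (2 * k))) \<and>
      even_ser (Suc k) = G_fps * X_series (d (Suc (Suc (2 * k))))" for k
  proof (induction k)
    case 0
    \<comment> \<open>The chain starts from G itself, and the 9 in \<open>d 1\<close> is the
      constant of \<open>section3_2_G\<close>.\<close>
    have "even_ser 0 = G_fps" by (simp add: even_ser_def g_def fps_eq_iff)
    moreover have "X_series (d (Suc 0)) = 9 * X_fps"
      unfolding X_series_def by (simp add: fps_numeral_fps_const)
    ultimately have "odd_ser 0 = cube_subst G_fps * X_series (d (Suc (2 * 0)))"
      by (simp add: odd_step section3_2_G)
    then show ?case
      using section3_0_X_series[of 0] by (simp only: even_step section3_cube_subst_mult[of 0, simplified])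
  next
    case (Suc k)
    then have "odd_ser (Suc k) = cube_subst G_fps * X_series (d (Suc (2 * Suc k)))"
      using section3_2_G_X_series[of k] by (simp add: odd_step del: d.simps)
    then show ?case
      using section3_0_X_series[of "Suc k"]
      by (simp only: even_step section3_cube_subst_mult[of 0, simplified])
  qed
  obtain k where k: "\<alpha> = Suc k" using assms by (cases \<alpha>) auto
  have e: "2 * \<alpha> - 1 = Suc (2 * k)" "2 * \<alpha> = Suc (Suc (2 * k))" by (simp_all add: k)
  have p: "(3::nat) ^ Suc (2 * k) = 3 * 9 ^ k" "(3::nat) ^ Suc (Suc (2 * k)) = 9 ^ Suc k"
    by (simp_all add: power_mult)
  show ?thesis
    using *[of k] unfolding e(1) unfolding e(2) p odd_ser_def even_ser_def cube_subst_G_fps[symmetric] G_fps_def[symmetric] .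
qed

end
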